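(* Let $d,\ell,N\ge 1$ be integers and let $f_i:\mathbb{R}^d\to\mathbb{R}^\ell$, $i\in\{1,\dots,N\}$, be Lipschitz continuous functions such that for every $x\in\mathbb{R}^d$ the vectors $\{f_1(x),\ldots,f_N(x)\}$ are affinely independent. Let $F:\mathbb{R}^d\rightrightarrows\mathbb{R}^\ell$ be the set-valued map $$F(x)=\mathrm{conv}\{f_1(x),\ldots,f_N(x)\},\qquad x\in\mathbb{R}^d.$$ Then for almost every $\bar x\in\mathbb{R}^d$ (with respect to Lebesgue measure) and for all $\bar y\in F(\bar x)$, the map $F$ is differentiable at $(\bar x,\bar y)$. In particular, for such $(\bar x,\bar y)$ and for every $u\in\mathbb{R}^d$, $$DF(\bar x,\bar y)(u)=\sum_{j=1}^N\bar\lambda_j\,df_j(\bar x)(u)+T_{F(\bar x)}(\bar y),$$ where $(\bar\lambda_1,\ldots,\bar\lambda_N)\in[0,1]^N$ with $\sum_{j=1}^N\bar\lambda_j=1$ is such that $\bar y=\sum_{j=1}^N\bar\lambda_j f_j(\bar x)$.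
   Context: Vectors $V_1,\dots,V_N$ are affinely independent if $\sum_i\mu_i=0$ and $\sum_i\mu_iV_i=0$ (with $\mu_i\in\mathbb{R}$) imply $\mu_1=\dots=\mu_N=0$. In particular, the coefficients $(\bar\lambda_j)$ representing $\bar y$ are unique. $\mathrm{conv}$ denotes the convex hull and $df_j(\bar x)$ the Fréchet derivative of $f_j$ at $\bar x$. For a closed set $K\subset\mathbb{R}^m$ and $\bar z\in K$, the tangent (contingent) cone is $$T_K(\bar z)=\{u\in\mathbb{R}^m:\ \exists\, h_n>0,\ h_n\to 0,\ \exists\, u_n\to u \text{ such that } \bar z+h_nu_n\in K\ \forall n\}.$$ A set-valued map $F:\mathbb{R}^d\rightrightarrows\mathbb{R}^\ell$ assigns to each $x$ a subset $F(x)\subset\mathbb{R}^\ell$; its graph is $\mathrm{gph}(F)=\{(x,y):\ y\in F(x)\}$. If $F$ has closed graph, its graphical derivative at $(\bar x,\bar y)\in\mathrm{gph}(F)$ is the set-valued map $DF(\bar x,\bar y):\mathbb{R}^d\rightrightarrows\mathbb{R}^\ell$ defined by $\mathrm{gph}(DF(\bar x,\bar y))=T_{\mathrm{gph}(F)}(\bar x,\bar y)$. A convex process is a set-valued map $\mathbb{R}^d\rightrightarrows\mathbb{R}^\ell$ whose graph is a closed convex cone in $\mathbb{R}^d\times\mathbb{R}^\ell$. $F$ (with closed graph) is said to be differentiable at $(\bar x,\bar y)\in\mathrm{gph}(F)$ if $DF(\bar x,\bar y)$ is a convex process, i.e. if the closed cone $T_{\mathrm{gph}(F)}(\bar x,\bar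 y)$ is convex. *)

theory Defs
  imports "HOL-Analysis.Analysis"
begin

(* Affine independence of an indexed family. Unlike the set-based affine_dependent, this also
   forces the vectors of the family to be pairwise distinct. *)
definition affinely_independent_on :: "'i set \<Rightarrow> ('i \<Rightarrow> 'a::real_vector) \<Rightarrow> bool"
  where "affinely_independent_on I V \<longleftrightarrow>
    (\<forall>\<mu> :: 'i \<Rightarrow> real.
      (\<Sum>i\<in>I. \<mu> i) = 0 \<and> (\<Sum>i\<in>I. \<mu> i *\<^sub>R V i) = 0 \<longrightarrow> (\<forall>i\<in>I. \<mu> i = 0))"

definition tangent_cone :: "'a::real_normed_vector set \<Rightarrow> 'a \<Rightarrow> 'a set"
  where "tangent_cone K z =
    {u. \<exists>(h :: nat \<Rightarrow> real) (w :: nat \<Rightarrow> 'a).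
          (\<forall>n. h n > 0) \<and> h \<longlonglongrightarrow> 0 \<and> w \<longlonglongrightarrow> u \<and> (\<forall>n. z + h n *\<^sub>R w n \<in> K)}"

definition gph :: "('a \<Rightarrow> 'b set) \<Rightarrow> ('a \<times> 'b) set"
  where "gph F = {(x, y). y \<in> F x}"

(* The set-valued map whose graph is the tangent cone to gph F at (x, y). *)
definition graphical_derivative ::
    "('a::real_normed_vector \<Rightarrow> 'b::real_normed_vector set) \<Rightarrow> 'a \<Rightarrow> 'b \<Rightarrow> 'a \<Rightarrow> 'b set"
  where "graphical_derivative F x y u = {v. (u, v) \<in> tangent_cone (gph F) (x, y)}"

lemma gph_graphical_derivative:
  "gph (graphical_derivative F x y) = tangent_cone (gph F) (x, y)"
  by (auto simp: gph_def graphical_derivative_def)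

definition convex_process ::
    "('a::real_normed_vector \<Rightarrow> 'b::real_normed_vector set) \<Rightarrow> bool"
  where "convex_process G \<longleftrightarrow> closed (gph G) \<and> convex_cone (gph G)"

(* The first two conjuncts are the standing requirements under which the graphical derivative
   of F at (x, y) is considered. *)
definition set_valued_differentiable_at ::
    "('a::real_normed_vector \<Rightarrow> 'b::real_normed_vector set) \<Rightarrow> 'a \<Rightarrow> 'b \<Rightarrow> bool"
  where "set_valued_differentiable_at F x y \<longleftrightarrow>
    closed (gph F) \<and> (x, y) \<in> gph F \<and> convex_process (graphical_derivative F x y)"

end

theory Submission
  imports Defs
begin


text \<open>
  The function \<open>f\<close> is differentiable almost everywhere by Rademacher's theorem, proved as follows.
  On the line, a monotone function \<open>F\<close> with slopes at most 1 has a Stieltjes measure \<open>\<mu>\<close> dominated by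
  Lebesgue measure. On the set \<open>E\<close> where the difference quotients are infinitely often below \<open>p\<close> and
  infinitely often above \<open>q > p\<close>, Vitali coverings give \<open>q |E| \<le> \<mu> E \<le> p |E|\<close>, so \<open>E\<close> is
  null. Tonelli's theorem transfers this to directional derivatives in \<open>\<real>\<^sup>d\<close>, these are
  almost everywhere linear in the direction, and the Lipschitz bound upgrades linear directional
  derivatives along a countable dense set of directions to a Frechet derivative.

  At a point \<open>x\<close> of differentiability, write a point of \<open>F(x + h u)\<close> near \<open>y\<close> with weights
  \<open>c'\<close>. By affine independence \<open>c'\<close> tends to the weights \<open>c\<close> of \<open>y\<close>, so replacing
  the \<open>f j (x + h u)\<close> by the \<open>f j x\<close> changes the difference quotient by
  \<open>\<Sum> c j (df j u)\<close> up to \<open>o(1)\<close>. Hence the tangent cone to the graph is a linear preimage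
  of the tangent cone to the convex set \<open>F x\<close>.
\<close>

subsection \<open>Lipschitz functions of one variable\<close>

text \<open>The Stieltjes measures of \<open>F\<close> and of \<open>\<lambda>x. x - F x\<close> add up to Lebesgue measure.\<close>

lemma interval_measure_le_lborel:
  fixes F :: "real \<Rightarrow> real"
  assumes mono: "\<And>x y. x \<le> y \<Longrightarrow> F x \<le> F y"
    and slope: "\<And>x y. x \<le> y \<Longrightarrow> F y - F x \<le> y - x"
    and A: "A \<in> sets borel"
  shows "emeasure (interval_measure F) A \<le> emeasure lborel A"
proof -
  define G where "G = (\<lambda>x. x - F x)"
  have contF: "continuous_on UNIV F"
  proof -
    have "1-lipschitz_on UNIV F"
    proof (rule lipschitz_onI)
      fix x y :: real
      show "dist (F x) (F y) \<le> 1 * dist x y"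
        using mono[of x y] mono[of y x] slope[of x y] slope[of y x]
        by (cases "x \<le> y") (auto simp: dist_real_def)
    qed simp
    then show ?thesis by (rule lipschitz_on_continuous_on)
  qed
  then have contG: "continuous_on UNIV G"
    unfolding G_def by (intro continuous_intros)
  have monoG: "x \<le> y \<Longrightarrow> G x \<le> G y" for x y
    using slope[of x y] by (simp add: G_def)
  \<comment> \<open>Continuity gives single points measure zero, so the formula for closed intervals
    carries over to the open boxes by which \<open>lborel_eqI\<close> characterises Lebesgue
    measure.\<close>
  have Ioo: "emeasure (interval_measure H) {l<..<u} = ennreal (H u - H l)"
    if "l \<le> u" and H: "continuous_on UNIV H" "\<And>x y. x \<le> y \<Longrightarrow> H x \<le> H y" for H l u
  proof -
    have pt: "emeasure (interval_measure H) {z} = 0" for z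
      using emeasure_interval_measure_Icc[of z z H] H by simp
    have "emeasure (interval_measure H) {l<..<u} = emeasure (interval_measure H) ({l<..<u} \<union> {l,u})"
    proof (rule emeasure_Un_null_set[symmetric])
      have "{l} \<union> {u} \<in> null_sets (interval_measure H)"
        by (rule null_sets.Un) (auto intro!: null_setsI simp: pt)
      then show "{l, u} \<in> null_sets (interval_measure H)" by (simp add: insert_commute)
    qed simp
    also have "{l<..<u} \<union> {l,u} = {l..u}" using \<open>l \<le> u\<close> by auto
    finally show ?thesis using emeasure_interval_measure_Icc[of l u H] H \<open>l \<le> u\<close> by simp
  qed
  define \<mu> where "\<mu> = (\<lambda>A. emeasure (interval_measure F) A + emeasure (interval_measure G) A)"
  define M where "M = measure_of UNIV (sets borel) \<mu>"
  have setsM: "sets M = sets borel"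
    unfolding M_def by (metis sets.sets_measure_of_eq space_borel)
  have emM: "emeasure M B = \<mu> B" if "B \<in> sets borel" for B
  proof (rule emeasure_measure_of[OF M_def])
    show "positive (sets M) \<mu>" by (simp add: positive_def \<mu>_def)
    show "countably_additive (sets M) \<mu>"
    proof (rule countably_additiveI)
      fix B :: "nat \<Rightarrow> real set"
      assume "range B \<subseteq> sets M" "disjoint_family B" "\<Union> (range B) \<in> sets M"
      then show "(\<Sum>i. \<mu> (B i)) = \<mu> (\<Union> (range B))"
        by (simp add: setsM \<mu>_def suminf_add[symmetric] suminf_emeasure)
    qed
  qed (use that setsM in auto)
  have "lborel = M"
  proof (rule lborel_eqI)
    fix l u :: real assume "\<And>b. b \<in> Basis \<Longrightarrow> l \<bullet> b \<le> u \<bullet> b"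
    then have "l \<le> u" by simp
    then have "\<mu> {l<..<u} = ennreal (F u - F l) + ennreal (G u - G l)"
      unfolding \<mu>_def using Ioo mono monoG contF contG by simp
    also have "\<dots> = ennreal (u - l)"
      using mono[OF \<open>l \<le> u\<close>] monoG[OF \<open>l \<le> u\<close>]
      by (subst ennreal_plus[symmetric]) (auto simp: G_def)
    finally show "emeasure M (box l u) = ennreal (\<Prod>b\<in>Basis. (u - l) \<bullet> b)"
      by (simp add: emM box_real)
  qed (simp add: setsM)
  then show ?thesis
    using emM[OF A] by (simp add: \<mu>_def)
qed

section \<open>Comparison of measures by Vitali coverings\<close>

text \<open>Inside an open \<open>U\<close> containing \<open>E\<close> with \<open>U - E\<close> of
  Lebesgue measure at most \<open>e\<close>, Vitali's theorem picks countably many disjoint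
  intervals that cover \<open>E\<close> up to a null set. The inequality is summed over them.
  Domination by Lebesgue measure makes the uncovered part null for \<open>\<nu>\<close> and bounds
  the excess of \<open>\<rho>\<close> by \<open>e\<close>, which then tends to 0.\<close>

lemma emeasure_le_of_Vitali_cover:
  fixes \<nu> \<rho> :: "real measure"
  assumes sets_\<nu>[measurable_cong]: "sets \<nu> = sets borel" and sets_\<rho>[measurable_cong]: "sets \<rho> = sets borel"
    and \<nu>_le: "\<And>A. A \<in> sets borel \<Longrightarrow> emeasure \<nu> A \<le> emeasure lborel A"
    and \<rho>_le: "\<And>A. A \<in> sets borel \<Longrightarrow> emeasure \<rho> A \<le> emeasure lborel A"
    and E[measurable]: "E \<in> sets borel"
    and cover: "\<And>x d. x \<in> E \<Longrightarrow> d > 0 \<Longrightarrow>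
      \<exists>a b. a < b \<and> x \<in> {a..b} \<and> b - a < d \<and> emeasure \<nu> {a..b} \<le> ennreal c * emeasure \<rho> {a..b}"
  shows "emeasure \<nu> E \<le> ennreal c * emeasure \<rho> E"
proof -
  have step: "emeasure \<nu> E \<le> ennreal c * (emeasure \<rho> E + ennreal e)" if "e > 0" for e :: real
  proof -
    obtain U where U: "open U" "E \<subseteq> U" "emeasure lborel (U - E) \<le> ennreal e"
      using outer_regular_lborel_le[OF E \<open>e > 0\<close>] by metis
    have [measurable]: "U \<in> sets borel" using U by simp
    define K where "K = {(a, b). a < b \<and> {a..b} \<subseteq> U \<and> emeasure \<nu> {a..b} \<le> ennreal c * emeasure \<rho> {a..b}}"
    \<comment> \<open>Vitali's theorem speaks of balls; an interval is the ball around its midpoint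
      with half its length as radius.\<close>
    have ball: "cball ((fst i + snd i) / 2) ((snd i - fst i) / 2) = {fst i..snd i}" for i :: "real \<times> real"
      by (auto simp: cball_eq_atLeastAtMost field_simps)
    obtain C where C: "countable C" "C \<subseteq> K"
      "pairwise (\<lambda>i j. disjnt {fst i..snd i} {fst j..snd j}) C"
      "negligible (E - (\<Union>i\<in>C. {fst i..snd i}))"
    proof (rule Vitali_covering_theorem_cballs[of K "\<lambda>i. (snd i - fst i) / 2" E "\<lambda>i. (fst i + snd i) / 2"])
      fix i assume "i \<in> K" then show "0 < (snd i - fst i) / 2" by (auto simp: K_def)
    next
      fix x d :: real assume "x \<in> E" "0 < d"
      obtain r where r: "r > 0" "ball x r \<subseteq> U"
        using U \<open>x \<in> E\<close> by (meson openE subsetD)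
      \<comment> \<open>A length below \<open>r\<close> keeps the interval, which contains
        \<open>x\<close>, inside the ball and hence inside \<open>U\<close>.\<close>
      obtain a b where ab: "a < b" "x \<in> {a..b}" "b - a < min d r"
        "emeasure \<nu> {a..b} \<le> ennreal c * emeasure \<rho> {a..b}"
        using cover[OF \<open>x \<in> E\<close>, of "min d r"] \<open>0 < d\<close> \<open>r > 0\<close> by auto
      have "{a..b} \<subseteq> ball x r" using ab by (auto simp: dist_real_def)
      then have "(a, b) \<in> K" using ab r by (auto simp: K_def)
      then show "\<exists>i. i \<in> K \<and> x \<in> cball ((fst i + snd i) / 2) ((snd i - fst i) / 2) \<and> (snd i - fst i) / 2 < d"
        using ab ball[of "(a, b)"] by (intro exI[of _ "(a, b)"]) (auto simp del: mem_cball)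
    qed (auto simp del: mem_cball simp: ball)
    define W where "W = (\<Union>i\<in>C. {fst i..snd i})"
    have W[measurable]: "W \<in> sets borel"
      unfolding W_def using C(1) by (intro sets.countable_UN') auto
    have disj: "disjoint_family_on (\<lambda>i. {fst i..snd i}) C"
      using C(3) unfolding disjoint_family_on_def pairwise_def disjnt_def by blast
    have UN: "emeasure M W = (\<integral>\<^sup>+i. emeasure M {fst i..snd i} \<partial>count_space C)"
      if "sets M = sets borel" for M :: "real measure"
      unfolding W_def by (rule emeasure_UN_countable) (use that C(1) disj in auto)
    have "emeasure lborel (E - W) = 0"
      using C(4) by (simp add: W_def[symmetric] negligible_iff_emeasure0)
    then have "emeasure \<nu> (E - W) = 0"
      using \<nu>_le[of "E - W"] by simp
    have "emeasure \<nu> E \<le> emeasure \<nu> (W \<union> (E - W))"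
      by (intro emeasure_mono) (auto simp: sets_\<nu>)
    also have "\<dots> \<le> emeasure \<nu> W + emeasure \<nu> (E - W)"
      by (intro emeasure_subadditive) (auto simp: sets_\<nu>)
    also have "\<dots> = (\<integral>\<^sup>+i. emeasure \<nu> {fst i..snd i} \<partial>count_space C)"
      using \<open>emeasure \<nu> (E - W) = 0\<close> UN[OF sets_\<nu>] by simp
    also have "\<dots> \<le> (\<integral>\<^sup>+i. ennreal c * emeasure \<rho> {fst i..snd i} \<partial>count_space C)"
      using C(2) by (intro nn_integral_mono) (auto simp: K_def)
    also have "\<dots> = ennreal c * emeasure \<rho> W"
      by (simp add: UN[OF sets_\<rho>] nn_integral_cmult)
    also have "\<dots> \<le> ennreal c * emeasure \<rho> (E \<union> (U - E))"
    proof -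
      have "W \<subseteq> E \<union> (U - E)" using C(2) by (fastforce simp: W_def K_def)
      then show ?thesis by (intro mult_left_mono emeasure_mono) (auto simp: sets_\<rho>)
    qed
    also have "\<dots> \<le> ennreal c * (emeasure \<rho> E + emeasure \<rho> (U - E))"
      by (intro mult_left_mono emeasure_subadditive) (auto simp: sets_\<rho>)
    also have "\<dots> \<le> ennreal c * (emeasure \<rho> E + ennreal e)"
      using \<rho>_le[of "U - E"] U(3) by (intro mult_left_mono add_left_mono) auto
    finally show ?thesis .
  qed
  show ?thesis
  proof (rule tendsto_lowerbound)
    have "((\<lambda>e. ennreal c * (emeasure \<rho> E + ennreal e)) \<longlongrightarrow> ennreal c * (emeasure \<rho> E + ennreal 0)) (at_right 0)"
      by (intro tendsto_intros ennreal_tendsto_cmult) auto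
    then show "((\<lambda>e. ennreal c * (emeasure \<rho> E + ennreal e)) \<longlongrightarrow> ennreal c * emeasure \<rho> E) (at_right 0)"
      by simp
    show "\<forall>\<^sub>F e in at_right 0. emeasure \<nu> E \<le> ennreal c * (emeasure \<rho> E + ennreal e)"
      using step by (auto simp: eventually_at_filter)
  qed simp
qed

section \<open>Sets of points with oscillating difference quotients\<close>

text \<open>Turns the filter statement into a countable intersection over \<open>n\<close>, the form
  needed for Borel measurability.\<close>

lemma frequently_at_0_iff:
  fixes P :: "real \<Rightarrow> bool"
  shows "(\<exists>\<^sub>F s in at 0. P s) \<longleftrightarrow> (\<forall>n. \<exists>s. s \<noteq> 0 \<and> \<bar>s\<bar> < inverse (real (Suc n)) \<and> P s)"
proof
  assume L: "\<exists>\<^sub>F s in at 0. P s"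
  show "\<forall>n. \<exists>s. s \<noteq> 0 \<and> \<bar>s\<bar> < inverse (real (Suc n)) \<and> P s"
  proof
    fix n
    have "\<forall>\<^sub>F s in at (0::real). s \<noteq> 0 \<and> \<bar>s\<bar> < inverse (real (Suc n))"
      unfolding eventually_at by (intro exI[of _ "inverse (real (Suc n))"]) (auto simp: dist_real_def)
    from frequently_eventually_frequently[OF L this]
    show "\<exists>s. s \<noteq> 0 \<and> \<bar>s\<bar> < inverse (real (Suc n)) \<and> P s"
      by (auto dest: frequently_ex)
  qed
next
  assume R: "\<forall>n. \<exists>s. s \<noteq> 0 \<and> \<bar>s\<bar> < inverse (real (Suc n)) \<and> P s"
  show "\<exists>\<^sub>F s in at 0. P s"
    unfolding frequently_def
  proof
    assume "\<forall>\<^sub>F s in at 0. \<not> P s"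
    then obtain d where d: "d > 0" "\<And>s. s \<noteq> 0 \<Longrightarrow> \<bar>s\<bar> < d \<Longrightarrow> \<not> P s"
      by (auto simp: eventually_at dist_real_def)
    obtain n where "inverse (real (Suc n)) < d" using reals_Archimedean[OF d(1)] by auto
    then show False using R d(2) by (meson less_trans)
  qed
qed

text \<open>For each fixed \<open>s \<noteq> 0\<close> the condition is open in \<open>x\<close>.
  The union over uncountably many \<open>s\<close> stays open, so the whole set is a countable
  intersection of open sets.\<close>

lemma sets_borel_frequently_quotient:
  fixes g :: "'a::real_normed_vector \<Rightarrow> real"
  assumes g: "continuous_on UNIV g" and V: "open V"
  shows "{x. \<exists>\<^sub>F s in at (0::real). (g (x + s *\<^sub>R v) - g x) / s \<in> V} \<in> sets borel"
proof -
  have "open {x. (g (x + s *\<^sub>R v) - g x) / s \<in> V}" if "s \<noteq> 0" for s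
  proof -
    have "continuous_on UNIV (\<lambda>x. (g (x + s *\<^sub>R v) - g x) / s)"
      using that by (intro continuous_intros continuous_on_compose2[OF g]) auto
    from open_vimage[OF V this] show ?thesis by (simp add: vimage_def)
  qed
  then have "open (\<Union>s\<in>{s. s \<noteq> 0 \<and> \<bar>s\<bar> < inverse (real (Suc n))}. {x. (g (x + s *\<^sub>R v) - g x) / s \<in> V})" for n
    by (intro open_UN) auto
  then have "(\<Inter>n. \<Union>s\<in>{s. s \<noteq> 0 \<and> \<bar>s\<bar> < inverse (real (Suc n))}. {x. (g (x + s *\<^sub>R v) - g x) / s \<in> V}) \<in> sets borel"
    by (intro sets.countable_INT') auto
  also have "(\<Inter>n. \<Union>s\<in>{s. s \<noteq> 0 \<and> \<bar>s\<bar> < inverse (real (Suc n))}. {x. (g (x + s *\<^sub>R v) - g x) / s \<in> V})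
     = {x. \<exists>\<^sub>F s in at (0::real). (g (x + s *\<^sub>R v) - g x) / s \<in> V}"
    unfolding frequently_at_0_iff by auto
  finally show ?thesis .
qed

text \<open>Intervals of slope below \<open>p\<close> and intervals of slope above \<open>q\<close>
  both form Vitali covers, so a piece \<open>A\<close> satisfies
  \<open>|A| \<le> (p / q) |A|\<close> with \<open>p / q < 1\<close>. Cutting down to bounded pieces
  makes \<open>|A|\<close> finite, which allows the conclusion \<open>|A| = 0\<close>.\<close>

lemma null_set_oscillating_slopes_mono:
  fixes F :: "real \<Rightarrow> real"
  assumes mono: "\<And>x y. x \<le> y \<Longrightarrow> F x \<le> F y"
    and slope: "\<And>x y. x \<le> y \<Longrightarrow> F y - F x \<le> y - x"
    and contF: "continuous_on UNIV F"
    and "p < q"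
  shows "{x. (\<exists>\<^sub>F s in at 0. (F (x + s) - F x) / s < p) \<and> (\<exists>\<^sub>F s in at 0. (F (x + s) - F x) / s > q)}
    \<in> null_sets lborel" (is "?E \<in> _")
proof -
  define \<mu> where "\<mu> = interval_measure F"
  have \<mu>_le: "emeasure \<mu> A \<le> emeasure lborel A" if "A \<in> sets borel" for A
    unfolding \<mu>_def using interval_measure_le_lborel[OF mono slope that] by simp
  have sets_\<mu>: "sets \<mu> = sets borel" by (simp add: \<mu>_def)
  have \<mu>_Icc: "emeasure \<mu> {a..b} = ennreal (F b - F a)" if "a \<le> b" for a b
    unfolding \<mu>_def using emeasure_interval_measure_Icc[OF that mono contF] .
  have E: "?E \<in> sets borel"
    using sets.Int[OF sets_borel_frequently_quotient[OF contF, of "{..<p}" 1]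
        sets_borel_frequently_quotient[OF contF, of "{q<..}" 1]]
    by (simp add: Collect_conj_eq)
  have q_nonneg: "(F (x + s) - F x) / s \<ge> 0" if "s \<noteq> 0" for x s
    using mono[of x "x + s"] mono[of "x + s" x] that
    by (cases "s > 0") (auto simp: divide_nonpos_nonpos)
  \<comment> \<open>A step \<open>s\<close> of either sign gives an interval with \<open>x\<close>
    as one endpoint; the slope does not change when the endpoints are swapped. The predicate
    \<open>R\<close> serves both for "below \<open>p\<close>" and for "above
    \<open>q\<close>".\<close>
  have slope_interval: "\<exists>a b. a < b \<and> x \<in> {a..b} \<and> b - a < d \<and> (\<exists>t. R t \<and> F b - F a = t * (b - a))"
    if fr: "\<exists>\<^sub>F s in at 0. R ((F (x + s) - F x) / s)" and "d > 0" for R x d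
  proof -
    have "\<forall>\<^sub>F s in at (0::real). s \<noteq> 0 \<and> \<bar>s\<bar> < d"
      unfolding eventually_at using \<open>d > 0\<close> by (auto simp: dist_real_def)
    from frequently_eventually_frequently[OF fr this]
    obtain s where s: "R ((F (x + s) - F x) / s)" "s \<noteq> 0" "\<bar>s\<bar> < d"
      by (auto dest: frequently_ex)
    show ?thesis
    proof (cases "s > 0")
      case True
      then show ?thesis using s by (intro exI[of _ x] exI[of _ "x + s"]) auto
    next
      case False
      then show ?thesis using s
        by (intro exI[of _ "x + s"] exI[of _ x]) (auto intro!: exI[of _ "(F (x + s) - F x) / s"] simp: field_simps)
    qed
  qed
  have null: "?E \<inter> {-real n..real n} \<in> null_sets lborel" for n
  proof (cases "?E = {}")
    case True
    show ?thesis unfolding True by simp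
  next
    case False
    then obtain x where "\<exists>\<^sub>F s in at 0. (F (x + s) - F x) / s < p" by auto
    then have "\<exists>\<^sub>F s in at 0. (F (x + s) - F x) / s < p \<and> s \<noteq> 0"
      by (rule frequently_eventually_frequently) (auto simp: eventually_at_filter)
    then obtain s where "(F (x + s) - F x) / s < p" "s \<noteq> 0" by (auto dest: frequently_ex)
    \<comment> \<open>Quotients of a nondecreasing function are nonnegative, so one of them below
      \<open>p\<close> makes \<open>p\<close> positive. The factors \<open>ennreal p\<close> and
      \<open>ennreal (1 / q)\<close> then multiply as in the reals.\<close>
    then have "p > 0" using q_nonneg[of s x] by simp
    define A where "A = ?E \<inter> {-real n..real n}"
    have A: "A \<in> sets borel" unfolding A_def using E by (intro sets.Int) auto
    have "emeasure lborel A \<le> emeasure lborel {-real n..real n}"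
      by (rule emeasure_mono) (auto simp: A_def)
    then have finA: "emeasure lborel A < top"
      by (rule le_less_trans) (simp add: ennreal_less_top)
    have "emeasure \<mu> A \<le> ennreal p * emeasure lborel A"
    proof (rule emeasure_le_of_Vitali_cover[OF sets_\<mu> _ \<mu>_le _ A])
      fix x d :: real assume "x \<in> A" "d > 0"
      then obtain a b t where "a < b" "x \<in> {a..b}" "b - a < d" "t < p" "F b - F a = t * (b - a)"
        using slope_interval[of "\<lambda>t. t < p" x d] unfolding A_def by blast
      then show "\<exists>a b. a < b \<and> x \<in> {a..b} \<and> b - a < d \<and> emeasure \<mu> {a..b} \<le> ennreal p * emeasure lborel {a..b}"
        using \<open>p > 0\<close> by (intro exI[of _ a] exI[of _ b]) (auto simp: \<mu>_Icc ennreal_mult'[symmetric] intro!: ennreal_leI)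
    qed auto
    moreover have "emeasure lborel A \<le> ennreal (1 / q) * emeasure \<mu> A"
    proof (rule emeasure_le_of_Vitali_cover[OF _ sets_\<mu> _ \<mu>_le A])
      fix x d :: real assume "x \<in> A" "d > 0"
      then obtain a b t where "a < b" "x \<in> {a..b}" "b - a < d" "q < t" "F b - F a = t * (b - a)"
        using slope_interval[of "\<lambda>t. q < t" x d] unfolding A_def by blast
      moreover have "b - a \<le> 1 / q * (t * (b - a))"
      proof -
        have "q * (b - a) \<le> t * (b - a)"
          using \<open>q < t\<close> \<open>a < b\<close> by (intro mult_right_mono) auto
        then show ?thesis using \<open>p > 0\<close> \<open>p < q\<close> by (simp add: field_simps)
      qed
      ultimately show "\<exists>a b. a < b \<and> x \<in> {a..b} \<and> b - a < d \<and> emeasure lborel {a..b} \<le> ennreal (1 / q) * emeasure \<mu> {a..b}"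
        using \<open>p > 0\<close> \<open>p < q\<close> by (intro exI[of _ a] exI[of _ b]) (auto simp: \<mu>_Icc ennreal_mult'[symmetric] intro!: ennreal_leI)
    qed auto
    ultimately have "emeasure lborel A \<le> ennreal (1 / q) * (ennreal p * emeasure lborel A)"
      by (meson mult_left_mono order_trans zero_le)
    then have "emeasure lborel A \<le> ennreal (p / q) * emeasure lborel A"
      using \<open>p > 0\<close> \<open>p < q\<close> by (simp add: mult.assoc[symmetric] ennreal_mult'[symmetric])
    moreover obtain r where "emeasure lborel A = ennreal r" "r \<ge> 0"
      using finA by (cases "emeasure lborel A") auto
    ultimately have "r \<le> p / q * r"
      using \<open>p > 0\<close> \<open>p < q\<close> by (simp add: ennreal_mult'[symmetric])
    then have "r * (q - p) \<le> 0" using \<open>p > 0\<close> \<open>p < q\<close> by (simp add: field_simps)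
    then have "r = 0" using \<open>p < q\<close> \<open>r \<ge> 0\<close> by (simp add: mult_le_0_iff)
    then show ?thesis using \<open>emeasure lborel A = ennreal r\<close> A by (auto simp: A_def)
  qed
  have "(\<Union>n. ?E \<inter> {-real n..real n}) \<in> null_sets lborel"
    using null by (intro null_sets_UN) 
  moreover have "(\<Union>n. ?E \<inter> {-real n..real n}) = ?E"
  proof -
    have "\<exists>n. x \<in> {-real n..real n}" for x :: real
    proof -
      obtain n where "\<bar>x\<bar> \<le> real n" using real_arch_simple by blast
      then have "x \<in> {-real n..real n}" by (simp add: abs_le_iff)
      then show ?thesis ..
    qed
    then show ?thesis by blast
  qed
  ultimately show ?thesis by simp
qed


lemma null_set_oscillating_slopes:
  fixes f :: "real \<Rightarrow> real"
  assumes f: "L-lipschitz_on UNIV f" and "p < q"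
  shows "{x. (\<exists>\<^sub>F s in at 0. (f (x + s) - f x) / s < p) \<and> (\<exists>\<^sub>F s in at 0. (f (x + s) - f x) / s > q)}
    \<in> null_sets lborel" (is "?E \<in> _")
proof -
  \<comment> \<open>The added 1 keeps the divisor \<open>2 * K\<close> positive even if
    \<open>L = 0\<close>.\<close>
  define K where "K = L + 1"
  have "K > 0" using lipschitz_on_nonneg[OF f] by (simp add: K_def)
  have lip: "\<bar>f x - f y\<bar> \<le> K * \<bar>x - y\<bar>" for x y
    using lipschitz_onD[OF f, of x y] by (simp add: dist_real_def K_def algebra_simps)
  \<comment> \<open>an affine change of slopes from \<open>[-K, K]\<close> to \<open>[0, 1]\<close>\<close>
  define F where "F = (\<lambda>x. (f x + K * x) / (2 * K))"
  have sl: "(F (x + s) - F x) / s = ((f (x + s) - f x) / s + K) / (2 * K)" if "s \<noteq> 0" for x s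
    using that \<open>K > 0\<close> by (simp add: F_def field_simps)
  have lt: "(F (x + s) - F x) / s < (r + K) / (2 * K) \<longleftrightarrow> (f (x + s) - f x) / s < r"
    and gt: "(F (x + s) - F x) / s > (r + K) / (2 * K) \<longleftrightarrow> (f (x + s) - f x) / s > r" if "s \<noteq> 0" for x s r
    using that \<open>K > 0\<close> unfolding sl[OF that] by (simp_all add: divide_less_cancel)
  have "?E = {x. (\<exists>\<^sub>F s in at 0. (F (x + s) - F x) / s < (p + K) / (2 * K)) \<and>
      (\<exists>\<^sub>F s in at 0. (F (x + s) - F x) / s > (q + K) / (2 * K))}"
  proof (intro Collect_cong conj_cong)
    fix x
    show "(\<exists>\<^sub>F s in at 0. (f (x + s) - f x) / s < p) = (\<exists>\<^sub>F s in at 0. (F (x + s) - F x) / s < (p + K) / (2 * K))"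
      by (rule frequently_cong[of "\<lambda>s. s \<noteq> 0"]) (auto simp: lt eventually_at_filter)
    show "(\<exists>\<^sub>F s in at 0. (f (x + s) - f x) / s > q) = (\<exists>\<^sub>F s in at 0. (F (x + s) - F x) / s > (q + K) / (2 * K))"
      by (rule frequently_cong[of "\<lambda>s. s \<noteq> 0"]) (auto simp: gt eventually_at_filter)
  qed
  also have "\<dots> \<in> null_sets lborel"
  proof (rule null_set_oscillating_slopes_mono)
    fix x y :: real assume "x \<le> y"
    then have "- (K * (y - x)) \<le> f y - f x" "f y - f x \<le> K * (y - x)"
      using lip[of y x] by (simp_all add: abs_le_iff)
    moreover have "F y - F x = ((f y - f x) + K * (y - x)) / (2 * K)"
      by (simp add: F_def diff_divide_distrib[symmetric] algebra_simps)
    ultimately have "F y - F x \<ge> 0" "F y - F x \<le> y - x"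
      using \<open>K > 0\<close> by (simp_all add: pos_divide_le_eq)
    then show "F x \<le> F y" "F y - F x \<le> y - x" by simp_all
  next
    show "continuous_on UNIV F"
      unfolding F_def using \<open>K > 0\<close> lipschitz_on_continuous_on[OF f] by (intro continuous_intros) auto
    show "(p + K) / (2 * K) < (q + K) / (2 * K)"
      using \<open>K > 0\<close> \<open>p < q\<close> by (simp add: divide_strict_right_mono)
  qed
  finally show ?thesis .
qed

text \<open>By translation invariance the measure of \<open>N\<close> is the average over \<open>t \<in> [0,1]\<close> of the
  measures of \<open>N - t v\<close>; Tonelli's theorem then avoids any choice of coordinates.\<close>

lemma null_set_of_null_on_lines:
  fixes N :: "'a::euclidean_space set"
  assumes N[measurable]: "N \<in> sets borel"
    and lines: "\<And>x. {t. x + t *\<^sub>R v \<in> N} \<in> null_sets lborel"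
  shows "N \<in> null_sets lborel"
proof -
  have [measurable]: "Measurable.pred (lborel \<Otimes>\<^sub>M lborel) (\<lambda>(t, x). x + t *\<^sub>R v \<in> N)"
    unfolding split_beta by measurable
  have "emeasure lborel N = (\<integral>\<^sup>+(t::real). indicator {0..1} t * emeasure lborel N \<partial>lborel)"
    by (simp add: nn_integral_multc)
  also have "\<dots> = (\<integral>\<^sup>+t. (\<integral>\<^sup>+x. indicator {0..1} t * indicator N (x + t *\<^sub>R v) \<partial>lborel) \<partial>lborel)"
  proof (rule nn_integral_cong)
    fix t :: real
    have "emeasure lborel N = (\<integral>\<^sup>+x. indicator N x \<partial>distr lborel borel ((+) (t *\<^sub>R v)))"
      by (simp add: lborel_distr_plus)
    also have "\<dots> = (\<integral>\<^sup>+x. indicator N (x + t *\<^sub>R v) \<partial>lborel)"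
      by (subst nn_integral_distr) (auto simp: add.commute)
    finally show "indicator {0..1} t * emeasure lborel N = (\<integral>\<^sup>+x. indicator {0..1} t * indicator N (x + t *\<^sub>R v) \<partial>lborel)"
      by (simp add: nn_integral_cmult)
  qed
  also have "\<dots> = (\<integral>\<^sup>+x. (\<integral>\<^sup>+t. indicator {0..1} t * indicator N (x + t *\<^sub>R v) \<partial>lborel) \<partial>lborel)"
    by (rule lborel_pair.Fubini'[symmetric]) (unfold split_beta, measurable)
  also have "\<dots> = (\<integral>\<^sup>+(x::'a). 0 \<partial>lborel)"
  proof (rule nn_integral_cong)
    fix x
    have "AE t in lborel. x + t *\<^sub>R v \<notin> N" using AE_not_in[OF lines[of x]] by simp
    then have "(\<integral>\<^sup>+t. indicator {0..1} t * indicator N (x + t *\<^sub>R v) \<partial>lborel) = (\<integral>\<^sup>+(t::real). 0 \<partial>lborel)"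
      by (intro nn_integral_cong_AE) auto
    then show "(\<integral>\<^sup>+t. indicator {0..1} t * indicator N (x + t *\<^sub>R v) \<partial>lborel) = 0" by simp
  qed
  finally show ?thesis by (auto intro: null_setsI)
qed

subsection \<open>Directional derivatives\<close>

text \<open>If the lower limit were smaller than the upper one, two rationals would fit strictly
  between them and the function would oscillate across both. Restricting to rationals leaves only
  countably many null sets to discard later. The bound keeps both limits finite.\<close>

lemma convergent_or_oscillating:
  fixes g :: "real \<Rightarrow> real"
  assumes bd: "\<And>s. \<bar>g s\<bar> \<le> B"
    and osc: "\<And>p q. p \<in> \<rat> \<Longrightarrow> q \<in> \<rat> \<Longrightarrow> p < q \<Longrightarrow> \<not> ((\<exists>\<^sub>F s in at a. g s < p) \<and> (\<exists>\<^sub>F s in at a. g s > q))"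
  shows "\<exists>D. (g \<longlongrightarrow> D) (at a)"
proof -
  define l u where "l = Liminf (at a) (\<lambda>s. ereal (g s))" and "u = Limsup (at a) (\<lambda>s. ereal (g s))"
  have "l \<le> u" unfolding l_def u_def by (rule Liminf_le_Limsup) simp
  have lu: "\<not> l < u"
  proof
    assume "l < u"
    then obtain p' where p': "l < ereal p'" "ereal p' < u"
      using ereal_dense2 by blast
    obtain q' where q': "ereal p' < ereal q'" "ereal q' < u"
      using ereal_dense2[OF p'(2)] by blast
    obtain p where p: "p \<in> \<rat>" "p' < p" "p < (p' + q') / 2"
      using Rats_dense_in_real[of p' "(p' + q') / 2"] q' by auto
    obtain q where q: "q \<in> \<rat>" "(p' + q') / 2 < q" "q < q'"
      using Rats_dense_in_real[of "(p' + q') / 2" q'] q' by auto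
    have "\<exists>\<^sub>F s in at a. g s < p"
    proof (rule ccontr)
      assume "\<not> ?thesis"
      then have "\<forall>\<^sub>F s in at a. ereal p \<le> ereal (g s)"
        by (simp add: frequently_def not_less)
      then have "ereal p \<le> l" unfolding l_def by (rule Liminf_bounded)
      then show False using p' p by (metis less_ereal.simps(1) less_trans not_less)
    qed
    moreover have "\<exists>\<^sub>F s in at a. g s > q"
    proof (rule ccontr)
      assume "\<not> ?thesis"
      then have "\<forall>\<^sub>F s in at a. ereal (g s) \<le> ereal q"
        by (simp add: frequently_def not_less)
      then have "u \<le> ereal q" unfolding u_def by (rule Limsup_bounded)
      then show False using q' q by (metis less_ereal.simps(1) less_trans not_less)
    qed
    ultimately show False using osc[OF p(1) q(1)] p q by auto
  qed
  have "ereal (-B) \<le> l" unfolding l_def using bd by (intro Liminf_bounded always_eventually) (auto simp: abs_le_iff minus_le_iff)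
  moreover have "u \<le> ereal B" unfolding u_def using bd by (intro Limsup_bounded always_eventually) (auto simp: abs_le_iff)
  ultimately obtain D where D: "l = ereal D" "u = ereal D"
    using \<open>l \<le> u\<close> lu by (cases l; cases u) auto
  have "((\<lambda>s. ereal (g s)) \<longlongrightarrow> ereal D) (at a)"
    using D by (subst tendsto_iff_Liminf_eq_Limsup) (auto simp: l_def u_def)
  then show ?thesis by auto
qed

lemma lipschitz_quotient_bound:
  fixes f :: "'a::real_normed_vector \<Rightarrow> real"
  assumes "L-lipschitz_on UNIV f"
  shows "\<bar>(f (x + s *\<^sub>R v) - f x) / s\<bar> \<le> L * norm v"
\<comment> \<open>At \<open>s = 0\<close> division by zero yields 0, so the bound holds for every
  \<open>s\<close>, as \<open>convergent_or_oscillating\<close> requires.\<close>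
proof (cases "s = 0")
  case False
  have "\<bar>f (x + s *\<^sub>R v) - f x\<bar> \<le> L * norm (s *\<^sub>R v)"
    using lipschitz_onD[OF assms, of "x + s *\<^sub>R v" x] by (simp add: dist_norm)
  then show ?thesis using False by (simp add: abs_divide field_simps)
qed (use lipschitz_on_nonneg[OF assms] in auto)

text \<open>Along every line in direction \<open>v\<close> the function is Lipschitz in one real
  variable, so each oscillation set \<open>N p q\<close> with \<open>p < q\<close> meets every such
  line in a null set and is therefore null itself. Rational pairs \<open>p < q\<close> contribute
  countably many such sets.\<close>

lemma AE_directional_derivative:
  fixes f :: "'a::euclidean_space \<Rightarrow> real"
  assumes f: "L-lipschitz_on UNIV f"
  shows "AE x in lborel. \<exists>D. ((\<lambda>s. (f (x + s *\<^sub>R v) - f x) / s) \<longlongrightarrow> D) (at 0)"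
proof -
  define N where "N p q = {x. (\<exists>\<^sub>F s in at 0. (f (x + s *\<^sub>R v) - f x) / s < p) \<and>
      (\<exists>\<^sub>F s in at 0. (f (x + s *\<^sub>R v) - f x) / s > q)}" for p q
  have contf: "continuous_on UNIV f" by (rule lipschitz_on_continuous_on[OF f])
  have "N p q \<in> null_sets lborel" if "p < q" for p q
  proof (rule null_set_of_null_on_lines[of _ v])
    show "N p q \<in> sets borel" unfolding N_def
      using sets.Int[OF sets_borel_frequently_quotient[OF contf, of "{..<p}" v]
          sets_borel_frequently_quotient[OF contf, of "{q<..}" v]]
      by (simp add: Collect_conj_eq)
    fix x
    have "(L * norm v)-lipschitz_on UNIV (\<lambda>t. f (x + t *\<^sub>R v))"
    proof (rule lipschitz_onI)
      fix t u :: real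
      have "dist (f (x + t *\<^sub>R v)) (f (x + u *\<^sub>R v)) \<le> L * dist (x + t *\<^sub>R v) (x + u *\<^sub>R v)"
        by (rule lipschitz_onD[OF f]) auto
      also have "dist (x + t *\<^sub>R v) (x + u *\<^sub>R v) = norm v * dist t u"
        by (simp add: dist_norm scaleR_diff_left[symmetric])
      finally show "dist (f (x + t *\<^sub>R v)) (f (x + u *\<^sub>R v)) \<le> L * norm v * dist t u" by simp
    qed (use lipschitz_on_nonneg[OF f] in simp)
    from null_set_oscillating_slopes[OF this that]
    show "{t. x + t *\<^sub>R v \<in> N p q} \<in> null_sets lborel"
      by (simp add: N_def scaleR_add_left add.assoc)
  qed
  then have "AE x in lborel. \<forall>p\<in>\<rat>. \<forall>q\<in>\<rat>. p < q \<longrightarrow> x \<notin> N p q"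
    by (simp add: AE_ball_countable countable_rat AE_not_in)
  then show ?thesis
  proof eventually_elim
    case (elim x)
    show ?case
      by (rule convergent_or_oscillating[OF lipschitz_quotient_bound[OF f]]) (use elim in \<open>auto simp: N_def\<close>)
  qed
qed


text \<open>The density \<open>1 + h / K\<close> gives every box its Lebesgue measure, hence defines
  Lebesgue measure, and densities are unique almost everywhere. Boundedness of \<open>h\<close> is
  what makes this density nonnegative for a suitable \<open>K\<close>.\<close>

lemma AE_eq_0_of_box_integrals_0:
  fixes h :: "'a::euclidean_space \<Rightarrow> real"
  assumes h[measurable]: "h \<in> borel_measurable borel"
    and bd: "AE x in lborel. \<bar>h x\<bar> \<le> B"
    and zero: "\<And>a b. (\<integral>x. indicator (box a b) x * h x \<partial>lborel) = 0"
  shows "AE x in lborel. h x = 0"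
proof -
  define K where "K = \<bar>B\<bar> + 1"
  have K: "K > 0" by (simp add: K_def)
  \<comment> \<open>a nonnegative density which equals 1 exactly where \<open>h\<close> vanishes\<close>
  define k where "k = (\<lambda>x. (h x + K) / K)"
  have [measurable]: "k \<in> borel_measurable borel" unfolding k_def by measurable
  have k0: "AE x in lborel. k x \<ge> 0"
    using bd K by (auto simp: k_def K_def)
  have "lborel = density lborel (\<lambda>x. ennreal (k x))"
  proof (rule lborel_eqI)
    fix a b :: 'a assume ab: "\<And>i. i \<in> Basis \<Longrightarrow> a \<bullet> i \<le> b \<bullet> i"
    have ih: "integrable lborel (\<lambda>x. indicator (box a b) x * h x)"
    proof (rule Bochner_Integration.integrable_bound)
      show "integrable lborel (\<lambda>x. indicator (box a b) x * K)"
        by (intro integrable_mult_left integrable_real_indicator) (auto simp: emeasure_lborel_box_eq)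
      show "AE x in lborel. norm (indicator (box a b) x * h x) \<le> norm (indicator (box a b) x * K)"
        using bd by eventually_elim (auto simp: indicator_def K_def)
    qed measurable
    have ib: "integrable lborel (indicator (box a b) :: 'a \<Rightarrow> real)"
      by (rule integrable_real_indicator) (auto simp: emeasure_lborel_box_eq)
    have *: "indicator (box a b) x * k x = (indicator (box a b) x * h x) / K + indicator (box a b) x" for x
      using K by (simp add: k_def field_simps)
    have ik: "integrable lborel (\<lambda>x. indicator (box a b) x * k x)"
      unfolding * using ih ib by (intro Bochner_Integration.integrable_add integrable_divide_zero)
    have "emeasure (density lborel (\<lambda>x. ennreal (k x))) (box a b)
        = (\<integral>\<^sup>+x. ennreal (k x) * indicator (box a b) x \<partial>lborel)"
      by (rule emeasure_density) auto
    also have "\<dots> = (\<integral>\<^sup>+x. ennreal (indicator (box a b) x * k x) \<partial>lborel)"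
      by (intro nn_integral_cong) (auto simp: indicator_def)
    also have "\<dots> = ennreal (\<integral>x. indicator (box a b) x * k x \<partial>lborel)"
      using k0 by (intro nn_integral_eq_integral[OF ik]) (auto simp: indicator_def)
    also have "(\<integral>x. indicator (box a b) x * k x \<partial>lborel) = measure lborel (box a b)"
      unfolding * using ih ib zero by (simp add: Bochner_Integration.integral_add)
    also have "\<dots> = (\<Prod>i\<in>Basis. (b - a) \<bullet> i)"
      using ab by (simp add: measure_lborel_box)
    finally show "emeasure (density lborel (\<lambda>x. ennreal (k x))) (box a b) = ennreal (\<Prod>i\<in>Basis. (b - a) \<bullet> i)" .
  qed simp
  then have "density lborel (\<lambda>x. 1) = density lborel (\<lambda>x. ennreal (k x))"
    by (simp add: density_1)
  then have "AE x in lborel. 1 = ennreal (k x)"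
    by (subst (asm) sigma_finite_measure.density_unique_iff[OF sigma_finite_lborel]) auto
  then show ?thesis using k0
  proof eventually_elim
    case (elim x)
    then have "k x = 1" using ennreal_inj[of 1 "k x"] by simp
    then show ?case using K by (simp add: k_def)
  qed
qed

subsection \<open>Linearity of the directional derivatives and Rademacher's theorem\<close>

text \<open>Taken along a fixed sequence of step sizes so as to be Borel measurable in \<open>x\<close>; the value is
  unspecified where the limit does not exist.\<close>

definition directional_deriv :: "('a::real_normed_vector \<Rightarrow> real) \<Rightarrow> 'a \<Rightarrow> 'a \<Rightarrow> real" where
  "directional_deriv f v x = lim (\<lambda>n. (f (x + inverse (real (Suc n)) *\<^sub>R v) - f x) / inverse (real (Suc n)))"

text \<open>The steps \<open>1 / (n + 1)\<close> tend to 0 without reaching it, so wherever the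
  two-sided limit exists the sequential definition returns it.\<close>

lemma tendsto_directional:
  fixes f :: "'a::real_normed_vector \<Rightarrow> real"
  assumes "((\<lambda>s. (f (x + s *\<^sub>R v) - f x) / s) \<longlongrightarrow> D) (at 0)"
  shows "(\<lambda>n. (f (x + inverse (real (Suc n)) *\<^sub>R v) - f x) / inverse (real (Suc n))) \<longlonglongrightarrow> D"
    and "directional_deriv f v x = D"
proof -
  have "filterlim (\<lambda>n. inverse (real (Suc n))) (at 0) sequentially"
    using LIMSEQ_inverse_real_of_nat by (simp add: filterlim_at)
  from filterlim_compose[OF assms this]
  show "(\<lambda>n. (f (x + inverse (real (Suc n)) *\<^sub>R v) - f x) / inverse (real (Suc n))) \<longlonglongrightarrow> D" .
  then show "directional_deriv f v x = D" unfolding directional_deriv_def by (rule limI)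
qed

text \<open>Names the limit by a fixed function of \<open>x\<close>, which can be measured and
  integrated.\<close>

lemma AE_tendsto_directional:
  fixes f :: "'a::euclidean_space \<Rightarrow> real"
  assumes f: "L-lipschitz_on UNIV f"
  shows "AE x in lborel. ((\<lambda>s. (f (x + s *\<^sub>R v) - f x) / s) \<longlongrightarrow> directional_deriv f v x) (at 0)"
  using AE_directional_derivative[OF f, of v]
proof eventually_elim
  case (elim x)
  then obtain D where "((\<lambda>s. (f (x + s *\<^sub>R v) - f x) / s) \<longlongrightarrow> D) (at 0)" ..
  then show ?case using tendsto_directional(2) by fastforce
qed

text \<open>The difference quotient in direction \<open>v + w\<close> at \<open>x\<close> is the quotient in direction \<open>v\<close> at
  \<open>x + \<epsilon> w\<close> plus the quotient in direction \<open>w\<close> at \<open>x\<close>. Integrated over a box, the shift by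
  \<open>\<epsilon> w\<close> can be moved onto the indicator of the box, where it disappears in the limit.\<close>

lemma AE_directional_add:
  fixes f :: "'a::euclidean_space \<Rightarrow> real"
  assumes f: "L-lipschitz_on UNIV f"
  shows "AE x in lborel. directional_deriv f (v + w) x = directional_deriv f v x + directional_deriv f w x"
proof -
  define \<epsilon> where "\<epsilon> n = inverse (real (Suc n))" for n
  have \<epsilon>: "\<epsilon> \<longlonglongrightarrow> 0" "\<And>n. \<epsilon> n > 0" "\<And>n. \<epsilon> n \<le> 1"
    unfolding \<epsilon>_def using LIMSEQ_inverse_real_of_nat by (auto simp: inverse_le_1_iff)
  define g where "g v n x = (f (x + \<epsilon> n *\<^sub>R v) - f x) / \<epsilon> n" for v n x
  have [measurable]: "f \<in> borel_measurable borel"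
    using lipschitz_on_continuous_on[OF f] by (rule borel_measurable_continuous_onI)
  have [measurable]: "g v n \<in> borel_measurable borel" for v n
    unfolding g_def by measurable
  have [measurable]: "directional_deriv f v \<in> borel_measurable borel" for v
    unfolding directional_deriv_def by measurable
  have g_bound: "\<bar>g v n x\<bar> \<le> L * norm v" for v n x
    unfolding g_def by (rule lipschitz_quotient_bound[OF f])
  have g_lim: "AE x in lborel. (\<lambda>n. g v n x) \<longlonglongrightarrow> directional_deriv f v x" for v
    using AE_tendsto_directional[OF f, of v]
    by eventually_elim (auto simp: g_def \<epsilon>_def dest: tendsto_directional(1))
  have D_bound: "AE x in lborel. \<bar>directional_deriv f v x\<bar> \<le> L * norm v" for v
    using g_lim[of v]
  proof eventually_elim
    case (elim x)
    then show ?case using g_bound by (intro LIMSEQ_le_const2[OF tendsto_rabs[OF elim]]) auto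
  qed
  define h where "h x = directional_deriv f (v + w) x - directional_deriv f v x - directional_deriv f w x" for x
  have "AE x in lborel. h x = 0"
  proof (rule AE_eq_0_of_box_integrals_0)
    show "h \<in> borel_measurable borel" unfolding h_def by measurable
    show "AE x in lborel. \<bar>h x\<bar> \<le> L * norm (v + w) + L * norm v + L * norm w"
      using D_bound[of v] D_bound[of w] D_bound[of "v + w"]
      by eventually_elim (auto simp: h_def)
  next
    fix a b :: 'a
    obtain R where R: "R > 0" "box a b \<subseteq> ball 0 R"
      using bounded_box bounded_subset_ballD by blast
    \<comment> \<open>Since \<open>\<epsilon> n \<le> 1\<close>, this ball contains the box and all
      its translates by \<open>\<epsilon> n *\<^sub>R w\<close>; its indicator times a constant is
      the dominating function in every limit below.\<close>
    define Q where "Q = cball (0::'a) (R + norm w)"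
    have box_Q: "indicator (box a b) x \<le> (indicator Q x :: real)" for x
      proof -
      have "x \<in> Q" if "x \<in> box a b"
      proof -
        have "norm x < R" using R that by auto
        then show ?thesis using norm_ge_zero[of w] unfolding Q_def mem_cball_0 by linarith
      qed
      then show ?thesis by (auto simp: indicator_def)
    qed
    have shift_Q: "indicator (box a b) (x - \<epsilon> n *\<^sub>R w) \<le> (indicator Q x :: real)" for x n
    proof -
      have "x \<in> Q" if "x - \<epsilon> n *\<^sub>R w \<in> box a b"
      proof -
        have "norm (x - \<epsilon> n *\<^sub>R w) < R" using R that by auto
        moreover have "norm (\<epsilon> n *\<^sub>R w) \<le> norm w"
          using \<epsilon>(2,3)[of n] by (simp add: mult_left_le_one_le)
        moreover have "norm x \<le> norm (x - \<epsilon> n *\<^sub>R w) + norm (\<epsilon> n *\<^sub>R w)"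
          by (metis diff_add_cancel norm_triangle_ineq)
        ultimately show ?thesis by (simp add: Q_def)
      qed
      then show ?thesis by (auto simp: indicator_def)
    qed
    have iQ: "integrable lborel (\<lambda>x. indicator Q x * c)" for c :: real
      proof -
      have "emeasure lborel Q < \<infinity>"
        unfolding Q_def by (intro emeasure_bounded_finite bounded_cball)
      moreover have "Q \<in> sets lborel" by (simp add: Q_def)
      ultimately show ?thesis by (intro integrable_mult_left integrable_real_indicator)
    qed
    have lim_box: "(\<lambda>n. \<integral>x. indicator (box a b) x * g u n x \<partial>lborel) \<longlonglongrightarrow>
        (\<integral>x. indicator (box a b) x * directional_deriv f u x \<partial>lborel)"
      and int_box: "integrable lborel (\<lambda>x. indicator (box a b) x * directional_deriv f u x)"
      and int_g: "\<And>n. integrable lborel (\<lambda>x. indicator (box a b) x * g u n x)" for u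
    proof -
      have 1: "AE x in lborel. (\<lambda>n. indicator (box a b) x * g u n x) \<longlonglongrightarrow> indicator (box a b) x * directional_deriv f u x"
        using g_lim[of u] by eventually_elim (intro tendsto_intros)
      have 2: "AE x in lborel. norm (indicator (box a b) x * g u n x) \<le> indicator Q x * (L * norm u)" for n
        using g_bound[of u n] box_Q lipschitz_on_nonneg[OF f]
        by (intro always_eventually allI) (auto simp: abs_mult intro!: mult_mono)
      show "(\<lambda>n. \<integral>x. indicator (box a b) x * g u n x \<partial>lborel) \<longlonglongrightarrow>
        (\<integral>x. indicator (box a b) x * directional_deriv f u x \<partial>lborel)"
        by (rule integral_dominated_convergence[OF _ _ iQ 1 2]) measurable
      show "integrable lborel (\<lambda>x. indicator (box a b) x * directional_deriv f u x)"
        by (rule integrable_dominated_convergence[OF _ _ iQ 1 2]) measurable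
      show "integrable lborel (\<lambda>x. indicator (box a b) x * g u n x)" for n
        by (rule integrable_dominated_convergence2[OF _ _ iQ 1 2]) measurable
    qed
    have lim_shift: "(\<lambda>n. \<integral>x. indicator (box a b) (x - \<epsilon> n *\<^sub>R w) * g v n x \<partial>lborel) \<longlonglongrightarrow>
        (\<integral>x. indicator (box a b) x * directional_deriv f v x \<partial>lborel)"
    proof (rule integral_dominated_convergence[OF _ _ iQ[of "L * norm v"]])
      \<comment> \<open>Off the frontier, small translations do not change membership in the box, so
        the shifted indicators are eventually constant.\<close>
      have "negligible (frontier (box a b))" by (rule negligible_convex_frontier) simp
      then have "AE x in lborel. x \<notin> frontier (box a b)"
        by (simp add: negligible_iff_null_sets null_sets_completion_iff AE_not_in)
      then show "AE x in lborel. (\<lambda>n. indicator (box a b) (x - \<epsilon> n *\<^sub>R w) * g v n x) \<longlonglongrightarrow> indicator (box a b) x * directional_deriv f v x"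
        using g_lim[of v]
      proof eventually_elim
        case (elim x)
        have lim: "(\<lambda>n. x - \<epsilon> n *\<^sub>R w) \<longlonglongrightarrow> x"
          using tendsto_diff[OF tendsto_const tendsto_scaleR[OF \<epsilon>(1) tendsto_const], of x w] by simp
        have "\<forall>\<^sub>F n in sequentially. (indicator (box a b) (x - \<epsilon> n *\<^sub>R w) :: real) = indicator (box a b) x"
        proof (cases "x \<in> box a b")
          case True
          from topological_tendstoD[OF lim open_box this]
          show ?thesis by eventually_elim (simp add: True)
        next
          case False
          then have "x \<in> - closure (box a b)" using elim(1) using interior_subset[of "box a b"] by (auto simp: frontier_def)
          from topological_tendstoD[OF lim open_Compl[OF closed_closure] this]
          have "\<forall>\<^sub>F n in sequentially. x - \<epsilon> n *\<^sub>R w \<in> - closure (box a b)" by simp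
          then show ?thesis by eventually_elim (use False closure_subset[of "box a b"] in \<open>auto simp: indicator_def\<close>)
        qed
        then have "(\<lambda>n. indicator (box a b) (x - \<epsilon> n *\<^sub>R w) :: real) \<longlonglongrightarrow> indicator (box a b) x"
          by (rule tendsto_eventually)
        then show ?case using elim(2) by (intro tendsto_intros)
      qed
      show "AE x in lborel. norm (indicator (box a b) (x - \<epsilon> n *\<^sub>R w) * g v n x) \<le> indicator Q x * (L * norm v)" for n
        using g_bound[of v n] shift_Q lipschitz_on_nonneg[OF f]
        by (intro always_eventually allI) (auto simp: abs_mult intro!: mult_mono)
    qed measurable
    have split: "(\<integral>x. indicator (box a b) x * g (v + w) n x \<partial>lborel) =
        (\<integral>x. indicator (box a b) (x - \<epsilon> n *\<^sub>R w) * g v n x \<partial>lborel) + (\<integral>x. indicator (box a b) x * g w n x \<partial>lborel)" for n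
    proof -
      have eq: "indicator (box a b) x * g (v + w) n x - indicator (box a b) x * g w n x =
          indicator (box a b) x * g v n (x + \<epsilon> n *\<^sub>R w)" for x
        unfolding g_def by (simp add: diff_divide_distrib algebra_simps)
      have "(\<integral>x. indicator (box a b) (x - \<epsilon> n *\<^sub>R w) * g v n x \<partial>lborel) =
          (\<integral>x. indicator (box a b) (x - \<epsilon> n *\<^sub>R w) * g v n x \<partial>distr lborel borel ((+) (\<epsilon> n *\<^sub>R w)))"
        by (simp add: lborel_distr_plus)
      also have "\<dots> = (\<integral>x. indicator (box a b) x * g v n (x + \<epsilon> n *\<^sub>R w) \<partial>lborel)"
        by (subst integral_distr) (auto simp: add.commute)
      also have "\<dots> = (\<integral>x. indicator (box a b) x * g (v + w) n x \<partial>lborel) - (\<integral>x. indicator (box a b) x * g w n x \<partial>lborel)"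
        unfolding eq[symmetric] by (rule Bochner_Integration.integral_diff[OF int_g int_g])
      finally show ?thesis by simp
    qed
    have "(\<integral>x. indicator (box a b) x * directional_deriv f (v + w) x \<partial>lborel) =
       (\<integral>x. indicator (box a b) x * directional_deriv f v x \<partial>lborel) + (\<integral>x. indicator (box a b) x * directional_deriv f w x \<partial>lborel)"
      by (rule LIMSEQ_unique[OF lim_box]) (unfold split, intro tendsto_add lim_shift lim_box)
    moreover have "indicator (box a b) x * h x = indicator (box a b) x * directional_deriv f (v + w) x -
        indicator (box a b) x * directional_deriv f v x - indicator (box a b) x * directional_deriv f w x" for x
      by (simp add: h_def algebra_simps)
    ultimately show "(\<integral>x. indicator (box a b) x * h x \<partial>lborel) = 0"
      by (simp add: int_box)
  qed
  then show ?thesis by eventually_elim (simp add: h_def)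
qed

lemma AE_directional_scale:
  fixes f :: "'a::euclidean_space \<Rightarrow> real"
  assumes f: "L-lipschitz_on UNIV f"
  shows "AE x in lborel. directional_deriv f (c *\<^sub>R v) x = c * directional_deriv f v x"
  using AE_tendsto_directional[OF f, of v]
proof eventually_elim
  case (elim x)
  show ?case
  proof (cases "c = 0")
    case True
    then show ?thesis by (auto simp: directional_deriv_def intro!: limI)
  next
    case False
    \<comment> \<open>Substituting \<open>s * c\<close> for \<open>s\<close> is legitimate because
      it tends to 0 while avoiding 0, which is where \<open>c \<noteq> 0\<close> enters; the outer
      factor \<open>c\<close> restores the denominator \<open>s\<close>.\<close>
    have "filterlim (\<lambda>s. s * c) (at 0) (at (0::real))"
      using False by (auto simp: filterlim_at eventually_at_filter intro!: tendsto_eq_intros)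
    from tendsto_mult_left[OF filterlim_compose[OF elim this], of c]
    have "((\<lambda>s. (f (x + s *\<^sub>R (c *\<^sub>R v)) - f x) / s) \<longlongrightarrow> c * directional_deriv f v x) (at 0)"
      using False by simp
    then show ?thesis by (rule tendsto_directional(2))
  qed
qed

lemma AE_directional_sum:
  fixes f :: "'a::euclidean_space \<Rightarrow> real"
  assumes f: "L-lipschitz_on UNIV f" and "finite I"
  shows "AE x in lborel. directional_deriv f (\<Sum>i\<in>I. u i) x = (\<Sum>i\<in>I. directional_deriv f (u i) x)"
  using \<open>finite I\<close>
proof induction
  case empty
  show ?case by (auto simp: directional_deriv_def intro!: limI)
next
  case (insert i I)
  show ?case
    using insert.IH AE_directional_add[OF f, of "u i" "\<Sum>i\<in>I. u i"]
    by eventually_elim (simp add: insert.hyps)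
qed

text \<open>Additivity and homogeneity are applied to the expansion of \<open>v\<close> in the
  standard basis. The exceptional null set depends on \<open>v\<close>, so linearity is available
  only for countably many directions at once.\<close>

lemma AE_directional_linear:
  fixes f :: "'a::euclidean_space \<Rightarrow> real"
  assumes f: "L-lipschitz_on UNIV f"
  shows "AE x in lborel. directional_deriv f v x = v \<bullet> (\<Sum>b\<in>Basis. directional_deriv f b x *\<^sub>R b)"
proof -
  have "AE x in lborel. \<forall>b\<in>Basis. directional_deriv f ((v \<bullet> b) *\<^sub>R b) x = (v \<bullet> b) * directional_deriv f b x"
    using AE_directional_scale[OF f] by (simp add: AE_ball_countable countable_finite)
  then show ?thesis
    using AE_directional_sum[OF f finite_Basis, of "\<lambda>b. (v \<bullet> b) *\<^sub>R b"]
    by eventually_elim (simp add: euclidean_representation inner_sum_right mult.commute)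
qed

section \<open>Frechet differentiability from a dense set of directions\<close>

text \<open>By compactness finitely many directions of \<open>S\<close> come within
  \<open>\<rho>\<close> of every unit vector, and over finitely many directions the limits are
  uniform. The Lipschitz bound and Cauchy-Schwarz carry the estimate over to the remaining
  directions.\<close>

lemma has_derivative_of_dense_directional:
  fixes f :: "'a::euclidean_space \<Rightarrow> real"
  assumes f: "L-lipschitz_on UNIV f"
    and dense: "\<And>U. open U \<Longrightarrow> U \<noteq> {} \<Longrightarrow> \<exists>v\<in>S. v \<in> U"
    and dir: "\<And>v. v \<in> S \<Longrightarrow> ((\<lambda>s. (f (x + s *\<^sub>R v) - f x) / s) \<longlongrightarrow> v \<bullet> g) (at 0)"
  shows "(f has_derivative (\<lambda>v. v \<bullet> g)) (at x)"
  unfolding has_derivative_at_alt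
proof (intro conjI allI impI)
  show "bounded_linear (\<lambda>v. v \<bullet> g)" by (rule bounded_linear_inner_left)
  fix e :: real assume "e > 0"
  \<comment> \<open>The three summands collect three errors, each a multiple of
    \<open>s * \<rho>\<close>: \<open>L\<close> from moving \<open>u\<close> to \<open>v\<close>
    inside \<open>f\<close>, \<open>norm g\<close> from doing so in the linear part, and 1 from the
    limit in direction \<open>v\<close>.\<close>
  define K where "K = L + norm g + 1"
  have "K > 0" using lipschitz_on_nonneg[OF f] by (simp add: K_def add_nonneg_pos)
  define \<rho> where "\<rho> = e / K"
  have "\<rho> > 0" using \<open>e > 0\<close> \<open>K > 0\<close> by (simp add: \<rho>_def)
  have "sphere 0 1 \<subseteq> (\<Union>v\<in>S. ball v \<rho>)"
  proof
    fix u :: 'a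
    show "u \<in> (\<Union>v\<in>S. ball v \<rho>)"
      using dense[of "ball u \<rho>"] \<open>\<rho> > 0\<close> by (auto simp: dist_commute)
  qed
  then obtain S' where S': "S' \<subseteq> S" "finite S'" "sphere 0 1 \<subseteq> (\<Union>v\<in>S'. ball v \<rho>)"
    using compactE_image[OF compact_sphere, of S "\<lambda>v. ball v \<rho>" "0::'a" 1] by auto
  have "\<forall>\<^sub>F s in at 0. \<forall>v\<in>S'. dist ((f (x + s *\<^sub>R v) - f x) / s) (v \<bullet> g) < \<rho>"
    using S' dir \<open>\<rho> > 0\<close> by (intro eventually_ball_finite ballI tendstoD) auto
  then obtain d where d: "d > 0"
    "\<And>s v. s \<noteq> 0 \<Longrightarrow> \<bar>s\<bar> < d \<Longrightarrow> v \<in> S' \<Longrightarrow> \<bar>(f (x + s *\<^sub>R v) - f x) / s - v \<bullet> g\<bar> < \<rho>"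
    unfolding eventually_at dist_real_def by auto
  have "norm (f y - f x - (y - x) \<bullet> g) \<le> e * norm (y - x)" if y: "norm (y - x) < d" for y
  proof (cases "y = x")
    case False
    define s u where "s = norm (y - x)" and "u = (y - x) /\<^sub>R s"
    have s: "s > 0" "s < d" using False y by (auto simp: s_def)
    have yx: "y = x + s *\<^sub>R u" using s by (simp add: u_def)
    have "u \<in> sphere 0 1" using s by (simp add: u_def s_def)
    then obtain v where v: "v \<in> S'" "norm (v - u) < \<rho>" using S' by (auto simp: dist_norm)
    have 1: "\<bar>f (x + s *\<^sub>R u) - f (x + s *\<^sub>R v)\<bar> \<le> L * (s * \<rho>)"
    proof -
      have "\<bar>f (x + s *\<^sub>R u) - f (x + s *\<^sub>R v)\<bar> \<le> L * norm (s *\<^sub>R (u - v))"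
        using lipschitz_onD[OF f, of "x + s *\<^sub>R u" "x + s *\<^sub>R v"] by (simp add: dist_norm scaleR_diff_right)
      also have "\<dots> \<le> L * (s * \<rho>)"
        using v(2) s lipschitz_on_nonneg[OF f] by (intro mult_left_mono) (auto simp: norm_minus_commute)
      finally show ?thesis .
    qed
    have 2: "\<bar>f (x + s *\<^sub>R v) - f x - s * (v \<bullet> g)\<bar> \<le> s * \<rho>"
    proof -
      have "f (x + s *\<^sub>R v) - f x - s * (v \<bullet> g) = s * ((f (x + s *\<^sub>R v) - f x) / s - v \<bullet> g)"
        using s by (simp add: field_simps)
      also have "\<bar>\<dots>\<bar> \<le> s * \<rho>"
        using d(2)[of s v] s v(1) by (simp add: abs_mult)
      finally show ?thesis .
    qed
    have 3: "\<bar>s * ((v - u) \<bullet> g)\<bar> \<le> s * (\<rho> * norm g)"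
    proof -
      have "\<bar>(v - u) \<bullet> g\<bar> \<le> norm (v - u) * norm g" by (rule Cauchy_Schwarz_ineq2)
      also have "\<dots> \<le> \<rho> * norm g" using v(2) by (intro mult_right_mono) auto
      finally show ?thesis using s by (simp add: abs_mult)
    qed
    have "f y - f x - (y - x) \<bullet> g = (f (x + s *\<^sub>R u) - f (x + s *\<^sub>R v)) +
        (f (x + s *\<^sub>R v) - f x - s * (v \<bullet> g)) + s * ((v - u) \<bullet> g)"
      by (simp add: yx inner_diff_left algebra_simps)
    then have "\<bar>f y - f x - (y - x) \<bullet> g\<bar> \<le> L * (s * \<rho>) + s * \<rho> + s * (\<rho> * norm g)"
      using 1 2 3 by linarith
    also have "\<dots> = s * (\<rho> * K)" by (simp add: K_def algebra_simps)
    also have "\<dots> = e * s" using \<open>K > 0\<close> by (simp add: \<rho>_def)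
    finally show ?thesis by (simp add: s_def)
  qed simp
  then show "\<exists>d>0. \<forall>y. norm (y - x) < d \<longrightarrow> norm (f y - f x - (y - x) \<bullet> g) \<le> e * norm (y - x)"
    using d(1) by blast
qed

text \<open>A countable dense set of directions keeps the union of the exceptional sets null; the
  candidate gradient is the vector of partial derivatives.\<close>

theorem Rademacher_real:
  fixes f :: "'a::euclidean_space \<Rightarrow> real"
  assumes f: "L-lipschitz_on UNIV f"
  shows "AE x in lborel. f differentiable (at x)"
proof -
  obtain S :: "'a set" where S: "countable S" "\<And>U. open U \<Longrightarrow> U \<noteq> {} \<Longrightarrow> \<exists>v\<in>S. v \<in> U"
    using countable_dense_setE by blast
  have "AE x in lborel. \<forall>v\<in>S. directional_deriv f v x = v \<bullet> (\<Sum>b\<in>Basis. directional_deriv f b x *\<^sub>R b)"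
    using AE_directional_linear[OF f] by (simp add: AE_ball_countable S)
  moreover have "AE x in lborel. \<forall>v\<in>S. ((\<lambda>s. (f (x + s *\<^sub>R v) - f x) / s) \<longlongrightarrow> directional_deriv f v x) (at 0)"
    using AE_tendsto_directional[OF f] by (simp add: AE_ball_countable S)
  ultimately show ?thesis
  proof eventually_elim
    case (elim x)
    show ?case
      using has_derivative_of_dense_directional[OF f S(2), of x "\<Sum>b\<in>Basis. directional_deriv f b x *\<^sub>R b"] elim
      by (auto simp: differentiable_def)
  qed
qed

theorem Rademacher:
  fixes f :: "'a::euclidean_space \<Rightarrow> 'b::euclidean_space"
  assumes f: "L-lipschitz_on UNIV f"
  shows "AE x in lborel. f differentiable (at x)"
proof -
  have "AE x in lborel. (\<lambda>x. f x \<bullet> i) differentiable (at x)" if "i \<in> Basis" for i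
  proof (rule Rademacher_real)
    show "L-lipschitz_on UNIV (\<lambda>x. f x \<bullet> i)"
    proof (rule lipschitz_onI)
      fix x y
      have "dist (f x \<bullet> i) (f y \<bullet> i) \<le> dist (f x) (f y)"
        using Basis_le_norm[OF that, of "f x - f y"] by (simp add: dist_norm inner_diff_left)
      also have "\<dots> \<le> L * dist x y" by (rule lipschitz_onD[OF f]) auto
      finally show "dist (f x \<bullet> i) (f y \<bullet> i) \<le> L * dist x y" .
    qed (rule lipschitz_on_nonneg[OF f])
  qed
  then have "AE x in lborel. \<forall>i\<in>Basis. (\<lambda>x. f x \<bullet> i) differentiable (at x)"
    by (simp add: AE_ball_countable countable_finite)
  then show ?thesis
    by eventually_elim (subst differentiable_componentwise_within, blast)
qed


subsection \<open>Tangent cones to graphs of simplex-valued maps\<close>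

text \<open>Affine independence of the \<open>V i\<close> is linear independence of the \<open>(V i, 1)\<close>, so the
  barycentric coordinates extend to linear functionals on the product space.\<close>

lemma affinely_independent_on_weights:
  fixes V :: "'i \<Rightarrow> 'a::euclidean_space"
  assumes fin: "finite I" and ind: "affinely_independent_on I V"
  obtains W :: "'i \<Rightarrow> 'a \<Rightarrow> real"
  where "\<And>j. j \<in> I \<Longrightarrow> continuous_on UNIV (W j)"
    and "\<And>c j. sum c I = 1 \<Longrightarrow> j \<in> I \<Longrightarrow> W j (\<Sum>i\<in>I. c i *\<^sub>R V i) = c j"
proof -
  define Z where "Z i = (V i, 1::real)" for i
  have zero: "\<mu> j = 0" if "(\<Sum>i\<in>I. \<mu> i *\<^sub>R Z i) = 0" "j \<in> I" for \<mu> j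
  proof -
    have "(\<Sum>i\<in>I. \<mu> i *\<^sub>R Z i) = (\<Sum>i\<in>I. \<mu> i *\<^sub>R V i, \<Sum>i\<in>I. \<mu> i)"
      by (simp add: Z_def prod_eq_iff fst_sum snd_sum)
    then show ?thesis using ind that by (auto simp: affinely_independent_on_def zero_prod_def)
  qed
  \<comment> \<open>Independence concerns the set of the \<open>Z i\<close>, so the family must
    first be shown to have no repetitions. A repetition \<open>Z i = Z j\<close> would give a
    vanishing combination with coefficients 1 and -1.\<close>
  have inj: "inj_on Z I"
  proof (rule inj_onI, rule ccontr)
    fix i j assume ij: "i \<in> I" "j \<in> I" "Z i = Z j" "i \<noteq> j"
    define \<mu> where "\<mu> k = (if k = i then 1 else 0) - (if k = j then 1::real else 0)" for k
    have "(\<Sum>k\<in>I. \<mu> k *\<^sub>R Z k) = Z i - Z j"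
      using ij fin by (simp add: \<mu>_def scaleR_diff_left sum_subtractf if_distrib[of "\<lambda>c. c *\<^sub>R _"] cong: if_cong)
    then have "\<mu> i = 0" using zero[of \<mu> i] ij by simp
    then show False using ij by (simp add: \<mu>_def)
  qed
  have indep: "independent (Z ` I)"
  proof (rule independent_if_scalars_zero)
    fix \<phi> z assume s: "(\<Sum>z\<in>Z ` I. \<phi> z *\<^sub>R z) = 0" and "z \<in> Z ` I"
    then obtain j where j: "j \<in> I" "z = Z j" by auto
    have "(\<Sum>i\<in>I. \<phi> (Z i) *\<^sub>R Z i) = 0" using s by (simp add: sum.reindex[OF inj])
    from zero[OF this j(1)] show "\<phi> z = 0" by (simp add: j)
  qed (simp add: fin)
  \<comment> \<open>These functionals are dual to the vectors \<open>Z i\<close>; restricted to the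
    height \<open>1\<close>, they read off barycentric coordinates.\<close>
  have "\<exists>G. linear G \<and> (\<forall>i\<in>I. G (Z i) = (if i = j then 1 else 0::real))" for j
  proof -
    obtain G where "linear G" "\<forall>z\<in>Z ` I. G z = (if the_inv_into I Z z = j then 1 else 0::real)"
      using linear_independent_extend[OF indep, of "\<lambda>z. if the_inv_into I Z z = j then 1 else 0"] by auto
    then show ?thesis by (auto simp: the_inv_into_f_f[OF inj])
  qed
  then obtain G where G: "\<And>j. linear (G j)" "\<And>i j. i \<in> I \<Longrightarrow> G j (Z i) = (if i = j then 1 else 0::real)"
    by metis
  show thesis
  proof (rule that[of "\<lambda>j y. G j (y, 1)"])
    show "continuous_on UNIV (\<lambda>y. G j (y, 1))" for j
      by (intro linear_continuous_on_compose[OF _ G(1)] continuous_intros)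
    show "G j (\<Sum>i\<in>I. c i *\<^sub>R V i, 1) = c j" if "sum c I = 1" "j \<in> I" for c j
    proof -
      have "(\<Sum>i\<in>I. c i *\<^sub>R V i, 1) = (\<Sum>i\<in>I. c i *\<^sub>R Z i)"
        using that by (simp add: Z_def prod_eq_iff fst_sum snd_sum)
      then have "G j (\<Sum>i\<in>I. c i *\<^sub>R V i, 1) = (\<Sum>i\<in>I. c i * G j (Z i))"
        by (simp add: linear_sum[OF G(1)] linear_scale[OF G(1)])
      also have "\<dots> = c j"
        using fin that(2) by (simp add: G(2) if_distrib[of "\<lambda>u. _ * u"] cong: if_cong)
      finally show ?thesis .
    qed
  qed
qed

text \<open>Weights indexed by \<open>I\<close>, rather than by the points themselves, can be kept
  fixed while the points \<open>f i x\<close> move with \<open>x\<close>.\<close>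

lemma convex_hull_image:
  fixes V :: "'i \<Rightarrow> 'a::real_vector"
  assumes "finite I"
  shows "convex hull (V ` I) = {\<Sum>i\<in>I. c i *\<^sub>R V i | c. (\<forall>i\<in>I. 0 \<le> c i) \<and> sum c I = 1}"
    (is "_ = ?R")
proof
  have "convex ?R"
  proof (rule convexI)
    fix x y and s t :: real
    assume "x \<in> ?R" "y \<in> ?R" and st: "0 \<le> s" "0 \<le> t" "s + t = 1"
    then obtain c d where "x = (\<Sum>i\<in>I. c i *\<^sub>R V i)" "\<forall>i\<in>I. 0 \<le> c i" "sum c I = 1"
      "y = (\<Sum>i\<in>I. d i *\<^sub>R V i)" "\<forall>i\<in>I. 0 \<le> d i" "sum d I = 1" by auto
    then show "s *\<^sub>R x + t *\<^sub>R y \<in> ?R" using st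
      by (intro CollectI exI[of _ "\<lambda>i. s * c i + t * d i"])
         (simp add: scaleR_add_left sum.distrib scaleR_sum_right sum_distrib_left[symmetric])
  qed
  moreover have "V ` I \<subseteq> ?R"
  proof
    fix v assume "v \<in> V ` I"
    then obtain j where "j \<in> I" "v = V j" by auto
    then show "v \<in> ?R" using assms
      by (intro CollectI exI[of _ "\<lambda>i. if i = j then 1 else 0"]) (auto simp: if_distrib[of "\<lambda>u. u *\<^sub>R _"] cong: if_cong)
  qed
  ultimately show "convex hull (V ` I) \<subseteq> ?R" by (rule hull_minimal[rotated])
  show "?R \<subseteq> convex hull (V ` I)"
  proof clarify
    fix c :: "'i \<Rightarrow> real" assume "\<forall>i\<in>I. 0 \<le> c i" "sum c I = 1"
    then show "(\<Sum>i\<in>I. c i *\<^sub>R V i) \<in> convex hull (V ` I)"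
      by (intro convex_sum[OF assms convex_convex_hull]) (auto intro: hull_inc)
  qed
qed

section \<open>Tangent cones and their convexity\<close>

text \<open>With one tolerance in place of two sequences, closedness of the cone follows from the
  triangle inequality without a diagonal argument.\<close>

lemma tangent_cone_iff:
  "u \<in> tangent_cone K z \<longleftrightarrow> (\<forall>e>0. \<exists>h w. 0 < h \<and> h < e \<and> dist w u < e \<and> z + h *\<^sub>R w \<in> K)"
proof
    assume "u \<in> tangent_cone K z"
    then obtain h w where hw: "\<And>n. h n > 0" "h \<longlonglongrightarrow> 0" "w \<longlonglongrightarrow> u" "\<And>n. z + h n *\<^sub>R w n \<in> K"
      by (auto simp: tangent_cone_def)
    show "\<forall>e>0. \<exists>h w. 0 < h \<and> h < e \<and> dist w u < e \<and> z + h *\<^sub>R w \<in> K"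
    proof (intro allI impI)
      fix e :: real assume "e > 0"
      have "\<forall>\<^sub>F n in sequentially. h n < e \<and> dist (w n) u < e"
        using order_tendstoD(2)[OF hw(2) \<open>e > 0\<close>] tendstoD[OF hw(3) \<open>e > 0\<close>] by eventually_elim simp
      then obtain n where "h n < e" "dist (w n) u < e"
        using eventually_happens trivial_limit_sequentially by blast
      then show "\<exists>h w. 0 < h \<and> h < e \<and> dist w u < e \<and> z + h *\<^sub>R w \<in> K" using hw by blast
    qed
  next
    assume R: "\<forall>e>0. \<exists>h w. 0 < h \<and> h < e \<and> dist w u < e \<and> z + h *\<^sub>R w \<in> K"
    have "\<forall>n. \<exists>h w. 0 < h \<and> h < inverse (real (Suc n)) \<and> dist w u < inverse (real (Suc n)) \<and> z + h *\<^sub>R w \<in> K"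
      using R by simp
    then obtain h w where hw: "\<And>n. 0 < h n" "\<And>n. h n < inverse (real (Suc n))"
      "\<And>n. dist (w n) u < inverse (real (Suc n))" "\<And>n. z + h n *\<^sub>R w n \<in> K"
      by metis
    have "h \<longlonglongrightarrow> 0"
      by (rule tendsto_sandwich[OF _ _ tendsto_const LIMSEQ_inverse_real_of_nat])
         (use hw in \<open>auto intro!: always_eventually intro: less_imp_le\<close>)
    moreover have "w \<longlonglongrightarrow> u"
      by (rule tendsto_dist_iff[THEN iffD2], rule tendsto_sandwich[OF _ _ tendsto_const LIMSEQ_inverse_real_of_nat])
         (simp_all add: less_imp_le[OF hw(3)] del: of_nat_Suc)
    ultimately show "u \<in> tangent_cone K z"
      unfolding tangent_cone_def using hw(1,4) by (intro CollectI exI[of _ h] exI[of _ w]) simp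
  qed

lemma closed_tangent_cone: "closed (tangent_cone K z)"
proof -
  have "u \<in> tangent_cone K z" if u: "u \<in> closure (tangent_cone K z)" for u
    unfolding tangent_cone_iff
  proof (intro allI impI)
    fix e :: real assume "e > 0"
    then obtain v where v: "v \<in> tangent_cone K z" "dist v u < e / 2"
      using u unfolding closure_approachable by (meson half_gt_zero)
    then obtain h w where "0 < h" "h < e / 2" "dist w v < e / 2" "z + h *\<^sub>R w \<in> K"
      using \<open>e > 0\<close> unfolding tangent_cone_iff by (meson half_gt_zero)
    moreover have "dist w u < e" using \<open>dist w v < e / 2\<close> v(2) dist_triangle[of w u v] by linarith
    ultimately show "\<exists>h w. 0 < h \<and> h < e \<and> dist w u < e \<and> z + h *\<^sub>R w \<in> K"
      using \<open>e > 0\<close> by (intro exI[of _ h] exI[of _ w]) auto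
  qed
  then show ?thesis by (metis closure_subset_eq subsetI)
qed

lemma convex_cone_tangent_cone:
  assumes "convex K" "z \<in> K"
  shows "convex_cone (tangent_cone K z)"
  unfolding convex_cone_iff
proof (intro conjI ballI allI impI)
  show "0 \<in> tangent_cone K z"
    unfolding tangent_cone_def using \<open>z \<in> K\<close> LIMSEQ_inverse_real_of_nat
    by (intro CollectI exI[of _ "\<lambda>n. inverse (real (Suc n))"] exI[of _ "\<lambda>n. 0"]) auto
next
  fix u v assume "u \<in> tangent_cone K z" "v \<in> tangent_cone K z"
  then obtain h w k y where h: "\<And>n. h n > (0::real)" "h \<longlonglongrightarrow> 0" "w \<longlonglongrightarrow> u" "\<And>n. z + h n *\<^sub>R w n \<in> K"
    and k: "\<And>n. k n > (0::real)" "k \<longlonglongrightarrow> 0" "y \<longlonglongrightarrow> v" "\<And>n. z + k n *\<^sub>R y n \<in> K"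
    unfolding tangent_cone_def by blast
  \<comment> \<open>the harmonic mean makes \<open>z + m (w + y)\<close> a convex combination of \<open>z + h w\<close> and \<open>z + k y\<close>\<close>
  define m where "m n = h n * k n / (h n + k n)" for n
  have m: "m n > 0" "m n \<le> h n" for n
    using h(1)[of n] k(1)[of n] by (auto simp: m_def field_simps)
  have "m \<longlonglongrightarrow> 0"
    by (rule tendsto_sandwich[OF _ _ tendsto_const h(2)]) (simp_all add: m less_imp_le[OF m(1)])
  moreover have "z + m n *\<^sub>R (w n + y n) \<in> K" for n
  proof -
    have s: "h n + k n > 0" using h(1)[of n] k(1)[of n] by simp
    have "(k n / (h n + k n)) *\<^sub>R (z + h n *\<^sub>R w n) + (h n / (h n + k n)) *\<^sub>R (z + k n *\<^sub>R y n) \<in> K"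
      using h k s \<open>convex K\<close> by (intro convexD) (auto simp: add_divide_distrib[symmetric] less_imp_le add.commute)
    also have "(k n / (h n + k n)) *\<^sub>R (z + h n *\<^sub>R w n) + (h n / (h n + k n)) *\<^sub>R (z + k n *\<^sub>R y n)
      = (k n / (h n + k n) + h n / (h n + k n)) *\<^sub>R z + m n *\<^sub>R (w n + y n)"
      by (simp add: m_def algebra_simps)
    also have "k n / (h n + k n) + h n / (h n + k n) = 1"
      using s by (simp add: add_divide_distrib[symmetric] add.commute)
    finally show ?thesis by simp
  qed
  ultimately show "u + v \<in> tangent_cone K z"
    unfolding tangent_cone_def using m h k
    by (intro CollectI exI[of _ m] exI[of _ "\<lambda>n. w n + y n"]) (auto intro: tendsto_add)
next
  fix u and c :: real assume "u \<in> tangent_cone K z" "c \<ge> 0"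
  then obtain h w where h: "\<And>n. h n > (0::real)" "h \<longlonglongrightarrow> 0" "w \<longlonglongrightarrow> u" "\<And>n. z + h n *\<^sub>R w n \<in> K"
    unfolding tangent_cone_def by blast
  show "c *\<^sub>R u \<in> tangent_cone K z"
  proof (cases "c = 0")
    case True
    then show ?thesis unfolding tangent_cone_def using \<open>z \<in> K\<close> LIMSEQ_inverse_real_of_nat
      by (intro CollectI exI[of _ "\<lambda>n. inverse (real (Suc n))"] exI[of _ "\<lambda>n. 0"]) auto
  next
    case False
    \<comment> \<open>Stretching the direction by \<open>c\<close> and dividing the step by
      \<open>c\<close> leaves the points of \<open>K\<close> unchanged.\<close>
    then show ?thesis unfolding tangent_cone_def using \<open>c \<ge> 0\<close> h
      by (intro CollectI exI[of _ "\<lambda>n. h n / c"] exI[of _ "\<lambda>n. c *\<^sub>R w n"])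
         (auto intro!: tendsto_intros tendsto_divide_zero)
  qed
qed

section \<open>Limits of difference quotients and of weighted sums\<close>

lemma has_derivative_sequentially:
  fixes f :: "'a::real_normed_vector \<Rightarrow> 'b::real_normed_vector"
  assumes D: "(f has_derivative f') (at x)"
    and h: "\<And>n. h n > 0" "h \<longlonglongrightarrow> (0::real)" and w: "w \<longlonglongrightarrow> u"
  shows "(\<lambda>n. (f (x + h n *\<^sub>R w n) - f x) /\<^sub>R h n) \<longlonglongrightarrow> f' u"
proof -
  interpret f': bounded_linear f' using D by (rule has_derivative_bounded_linear)
  \<comment> \<open>Division by zero makes \<open>\<psi> 0 = 0\<close>, so differentiability becomes
    continuity of \<open>\<psi>\<close> at 0, and increments with \<open>w n = 0\<close> are
    allowed.\<close>
  define \<psi> where "\<psi> k = norm (f (x + k) - f x - f' k) / norm k" for k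
  have "\<psi> \<midarrow>0\<rightarrow> \<psi> 0"
    using D by (simp add: \<psi>_def[abs_def] has_derivative_at)
  moreover have "(\<lambda>n. h n *\<^sub>R w n) \<longlonglongrightarrow> 0"
    using tendsto_scaleR[OF h(2) w] by simp
  ultimately have "(\<lambda>n. \<psi> (h n *\<^sub>R w n)) \<longlonglongrightarrow> \<psi> 0"
    by (intro isCont_tendsto_compose[where g=\<psi> and l=0]) (simp_all add: isCont_def)
  then have "(\<lambda>n. \<psi> (h n *\<^sub>R w n) * norm (w n)) \<longlonglongrightarrow> 0"
    using tendsto_mult[OF _ tendsto_norm[OF w]] by (fastforce simp: \<psi>_def)
  moreover have "norm ((f (x + h n *\<^sub>R w n) - f x) /\<^sub>R h n - f' (w n)) = \<psi> (h n *\<^sub>R w n) * norm (w n)" for n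
  proof (cases "w n = 0")
    case False
    have "(f (x + h n *\<^sub>R w n) - f x) /\<^sub>R h n - f' (w n) = (f (x + h n *\<^sub>R w n) - f x - f' (h n *\<^sub>R w n)) /\<^sub>R h n"
      using h(1)[of n] by (simp add: f'.scaleR algebra_simps)
    then show ?thesis using False h(1)[of n] by (simp add: \<psi>_def divide_inverse abs_of_pos)
  qed (simp add: f'.zero)
  ultimately have "(\<lambda>n. (f (x + h n *\<^sub>R w n) - f x) /\<^sub>R h n - f' (w n)) \<longlonglongrightarrow> 0"
    by (subst tendsto_norm_zero_iff[symmetric]) simp
  from tendsto_add[OF this f'.tendsto[OF w]] show ?thesis by simp
qed

text \<open>The weights need not converge. This permits replacing moving points by their limits
  before anything is known about the limits of the weights.\<close>

lemma tendsto_sum_bounded_weights: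
  fixes g :: "nat \<Rightarrow> 'i \<Rightarrow> 'a::real_normed_vector"
  assumes "\<And>i. i \<in> I \<Longrightarrow> (\<lambda>n. g n i) \<longlonglongrightarrow> 0"
    and "\<And>n i. i \<in> I \<Longrightarrow> \<bar>c n i\<bar> \<le> 1"
  shows "(\<lambda>n. \<Sum>i\<in>I. c n i *\<^sub>R g n i) \<longlonglongrightarrow> 0"
proof (rule tendsto_null_sum)
  fix i assume i: "i \<in> I"
  show "(\<lambda>n. c n i *\<^sub>R g n i) \<longlonglongrightarrow> 0"
  proof (rule tendsto_norm_zero_cancel, rule tendsto_sandwich[OF _ _ tendsto_const])
    show "(\<lambda>n. norm (g n i)) \<longlonglongrightarrow> 0" using assms(1)[OF i] by (rule tendsto_norm_zero)
    show "\<forall>\<^sub>F n in sequentially. norm (c n i *\<^sub>R g n i) \<le> norm (g n i)"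
      using assms(2)[OF i] by (simp add: mult_left_le_one_le)
  qed simp
qed

lemma weight_le_1:
  fixes c :: "'i \<Rightarrow> real"
  assumes "finite I" "\<forall>i\<in>I. 0 \<le> c i" "sum c I = 1" "i \<in> I"
  shows "\<bar>c i\<bar> \<le> 1"
proof -
  have "c i \<le> sum c I" using assms by (intro member_le_sum) auto
  then show ?thesis using assms by simp
qed

section \<open>Graph and graphical derivative of the convex hull map\<close>

text \<open>Replacing \<open>f i (fst (p n))\<close> by \<open>f i x\<close> under the same weights
  changes the points by a null sequence, so \<open>y\<close> is also a limit of points of the single
  closed hull at \<open>x\<close>.\<close>

lemma closed_gph_convex_hull:
  fixes f :: "'i \<Rightarrow> 'a::real_normed_vector \<Rightarrow> 'b::euclidean_space"
  assumes I: "finite I" and cont: "\<And>i. i \<in> I \<Longrightarrow> continuous_on UNIV (f i)"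
  shows "closed (gph (\<lambda>x. convex hull ((\<lambda>i. f i x) ` I)))"
  unfolding closed_sequential_limits
proof (intro allI impI, elim conjE)
  fix p :: "nat \<Rightarrow> 'a \<times> 'b" and l
  assume p: "\<forall>n. p n \<in> gph (\<lambda>x. convex hull ((\<lambda>i. f i x) ` I))" and lim: "p \<longlonglongrightarrow> l"
  obtain x y where l: "l = (x, y)" by (cases l)
  have x: "(\<lambda>n. fst (p n)) \<longlonglongrightarrow> x" and y: "(\<lambda>n. snd (p n)) \<longlonglongrightarrow> y"
    using tendsto_fst[OF lim] tendsto_snd[OF lim] l by simp_all
  have "\<forall>n. \<exists>c. snd (p n) = (\<Sum>i\<in>I. c i *\<^sub>R f i (fst (p n))) \<and> (\<forall>i\<in>I. 0 \<le> c i) \<and> sum c I = 1"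
    using p by (simp add: gph_def convex_hull_image[OF I] case_prod_beta)
  then obtain c where c: "\<And>n. snd (p n) = (\<Sum>i\<in>I. c n i *\<^sub>R f i (fst (p n)))"
    "\<And>n. \<forall>i\<in>I. 0 \<le> c n i" "\<And>n. sum (c n) I = 1"
    by metis
  have "(\<lambda>n. \<Sum>i\<in>I. c n i *\<^sub>R (f i (fst (p n)) - f i x)) \<longlonglongrightarrow> 0"
  proof (rule tendsto_sum_bounded_weights)
    fix i assume i: "i \<in> I"
    have "isCont (f i) x" using cont[OF i] by (simp add: continuous_on_eq_continuous_at)
    from isCont_tendsto_compose[OF this x] show "(\<lambda>n. f i (fst (p n)) - f i x) \<longlonglongrightarrow> 0"
      by (simp add: LIM_zero)
  qed (use weight_le_1[OF I c(2,3)] in blast)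
  from tendsto_diff[OF y this] have "(\<lambda>n. \<Sum>i\<in>I. c n i *\<^sub>R f i x) \<longlonglongrightarrow> y"
    by (simp add: c(1) scaleR_diff_right sum_subtractf)
  moreover have "(\<Sum>i\<in>I. c n i *\<^sub>R f i x) \<in> convex hull ((\<lambda>i. f i x) ` I)" for n
    using c by (auto simp: convex_hull_image[OF I])
  moreover have "closed (convex hull ((\<lambda>i. f i x) ` I))"
    using I by (intro compact_imp_closed finite_imp_compact_convex_hull) simp
  ultimately have "y \<in> convex hull ((\<lambda>i. f i x) ` I)"
    by (meson closed_sequentially)
  then show "l \<in> gph (\<lambda>x. convex hull ((\<lambda>i. f i x) ` I))" by (simp add: l gph_def)
qed

text \<open>A point of \<open>F\<close> at a nearby argument and a point of \<open>F x\<close> with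
  the same weights \<open>d n\<close> differ by a weighted sum of increments of the
  \<open>f i\<close>. Divided by the step \<open>h n\<close>, this sum tends to
  \<open>\<Sum> c i *\<^sub>R f' i u\<close>, so each direction of the equivalence subtracts or adds
  it.\<close>

lemma graphical_derivative_convex_hull:
  fixes f :: "'i \<Rightarrow> 'a::real_normed_vector \<Rightarrow> 'b::euclidean_space"
  assumes I: "finite I" and ind: "affinely_independent_on I (\<lambda>i. f i x)"
    and D: "\<And>i. i \<in> I \<Longrightarrow> (f i has_derivative f' i) (at x)"
    and F: "F = (\<lambda>x. convex hull ((\<lambda>i. f i x) ` I))"
    and c: "\<forall>i\<in>I. 0 \<le> c i" "sum c I = 1" and y: "y = (\<Sum>i\<in>I. c i *\<^sub>R f i x)"
  shows "v \<in> graphical_derivative F x y u \<longleftrightarrow> v - (\<Sum>i\<in>I. c i *\<^sub>R f' i u) \<in> tangent_cone (F x) y"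
proof -
  obtain W where W: "\<And>j. j \<in> I \<Longrightarrow> continuous_on UNIV (W j)"
    "\<And>c j. sum c I = 1 \<Longrightarrow> j \<in> I \<Longrightarrow> W j (\<Sum>i\<in>I. c i *\<^sub>R f i x) = (c j :: real)"
    using affinely_independent_on_weights[OF I ind] by metis
  \<comment> \<open>The weights are recovered by the continuous coordinates \<open>W i\<close>; this
    is where affine independence acts.\<close>
  have weights: "(\<lambda>n. d n i) \<longlonglongrightarrow> c i"
    if "\<And>n. sum (d n) I = 1" "(\<lambda>n. \<Sum>i\<in>I. d n i *\<^sub>R f i x) \<longlonglongrightarrow> y" "i \<in> I" for d i
  proof -
    have "isCont (W i) y" using W(1)[OF that(3)] by (simp add: continuous_on_eq_continuous_at)
    from isCont_tendsto_compose[OF this that(2)] show ?thesis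
      using W(2) that c y by simp
  qed
  have quot: "(\<lambda>n. \<Sum>i\<in>I. d n i *\<^sub>R ((f i (x + h n *\<^sub>R w n) - f i x) /\<^sub>R h n)) \<longlonglongrightarrow> (\<Sum>i\<in>I. c i *\<^sub>R f' i u)"
    if "\<And>i. i \<in> I \<Longrightarrow> (\<lambda>n. d n i) \<longlonglongrightarrow> c i" "\<And>n. h n > 0" "h \<longlonglongrightarrow> (0::real)" "w \<longlonglongrightarrow> u" for d h w
    by (intro tendsto_sum tendsto_scaleR that(1) has_derivative_sequentially[OF D]) (use that in auto)
  show ?thesis
  proof
    assume "v \<in> graphical_derivative F x y u"
    then obtain h p where h: "\<And>n. h n > (0::real)" "h \<longlonglongrightarrow> 0" and p: "p \<longlonglongrightarrow> (u, v)"
      and in_gph: "\<And>n. (x, y) + h n *\<^sub>R p n \<in> gph F"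
      unfolding graphical_derivative_def tangent_cone_def by blast
    have cancel: "h n *\<^sub>R (r *\<^sub>R (z /\<^sub>R h n)) = r *\<^sub>R z" for n r and z :: 'b
    proof -
      have "h n * (r * inverse (h n)) = r" using h(1)[of n] by (simp add: field_simps)
      then show ?thesis by simp
    qed
    define a b where "a n = fst (p n)" and "b n = snd (p n)" for n
    have a: "a \<longlonglongrightarrow> u" and b: "b \<longlonglongrightarrow> v"
      using tendsto_fst[OF p] tendsto_snd[OF p] by (simp_all add: a_def[abs_def] b_def[abs_def])
    have "y + h n *\<^sub>R b n \<in> F (x + h n *\<^sub>R a n)" for n
      using in_gph[of n] by (simp add: gph_def a_def b_def plus_prod_def scaleR_prod_def)
    then have "\<forall>n. \<exists>d. y + h n *\<^sub>R b n = (\<Sum>i\<in>I. d i *\<^sub>R f i (x + h n *\<^sub>R a n)) \<and> (\<forall>i\<in>I. 0 \<le> d i) \<and> sum d I = 1"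
      by (auto simp: F convex_hull_image[OF I])
    then obtain d where d: "\<And>n. y + h n *\<^sub>R b n = (\<Sum>i\<in>I. d n i *\<^sub>R f i (x + h n *\<^sub>R a n))"
      "\<And>n. \<forall>i\<in>I. 0 \<le> d n i" "\<And>n. sum (d n) I = 1"
      by metis
    have "(\<lambda>n. \<Sum>i\<in>I. d n i *\<^sub>R (f i (x + h n *\<^sub>R a n) - f i x)) \<longlonglongrightarrow> 0"
    proof (rule tendsto_sum_bounded_weights)
      fix i assume i: "i \<in> I"
      have "(\<lambda>n. x + h n *\<^sub>R a n) \<longlonglongrightarrow> x"
        using tendsto_add[OF tendsto_const tendsto_scaleR[OF h(2) a], of x] by simp
      from isCont_tendsto_compose[OF has_derivative_continuous[OF D[OF i]] this]
      show "(\<lambda>n. f i (x + h n *\<^sub>R a n) - f i x) \<longlonglongrightarrow> 0" by (simp add: LIM_zero)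
    qed (use weight_le_1[OF I d(2,3)] in blast)
    moreover have "(\<lambda>n. y + h n *\<^sub>R b n) \<longlonglongrightarrow> y"
      using tendsto_add[OF tendsto_const tendsto_scaleR[OF h(2) b], of y] by simp
    ultimately have "(\<lambda>n. y + h n *\<^sub>R b n - (\<Sum>i\<in>I. d n i *\<^sub>R (f i (x + h n *\<^sub>R a n) - f i x))) \<longlonglongrightarrow> y - 0"
      by (intro tendsto_diff)
    then have "(\<lambda>n. \<Sum>i\<in>I. d n i *\<^sub>R f i x) \<longlonglongrightarrow> y"
      by (simp add: d(1) scaleR_diff_right sum_subtractf)
    note dc = weights[OF d(3) this]
    \<comment> \<open>Chosen so that \<open>y + h n *\<^sub>R w n\<close> is the combination of the
      \<open>f i x\<close> with the weights \<open>d n\<close>.\<close>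
    define w where "w n = b n - (\<Sum>i\<in>I. d n i *\<^sub>R ((f i (x + h n *\<^sub>R a n) - f i x) /\<^sub>R h n))" for n
    have "w \<longlonglongrightarrow> v - (\<Sum>i\<in>I. c i *\<^sub>R f' i u)"
      unfolding w_def by (intro tendsto_diff b quot[OF dc h a])
    moreover have "y + h n *\<^sub>R w n \<in> F x" for n
    proof -
      have "h n *\<^sub>R (\<Sum>i\<in>I. d n i *\<^sub>R ((f i (x + h n *\<^sub>R a n) - f i x) /\<^sub>R h n))
          = (\<Sum>i\<in>I. d n i *\<^sub>R (f i (x + h n *\<^sub>R a n) - f i x))"
        unfolding scaleR_sum_right by (intro sum.cong refl cancel)
      then have "y + h n *\<^sub>R w n = (y + h n *\<^sub>R b n) - (\<Sum>i\<in>I. d n i *\<^sub>R (f i (x + h n *\<^sub>R a n) - f i x))"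
        by (simp add: w_def scaleR_diff_right)
      also have "\<dots> = (\<Sum>i\<in>I. d n i *\<^sub>R f i x)"
        by (simp add: d(1) scaleR_diff_right sum_subtractf)
      finally show ?thesis using d by (auto simp: F convex_hull_image[OF I])
    qed
    ultimately show "v - (\<Sum>i\<in>I. c i *\<^sub>R f' i u) \<in> tangent_cone (F x) y"
      unfolding tangent_cone_def using h by blast
  next
    assume "v - (\<Sum>i\<in>I. c i *\<^sub>R f' i u) \<in> tangent_cone (F x) y"
    then obtain h w where h: "\<And>n. h n > (0::real)" "h \<longlonglongrightarrow> 0" and w: "w \<longlonglongrightarrow> v - (\<Sum>i\<in>I. c i *\<^sub>R f' i u)"
      and in_F: "\<And>n. y + h n *\<^sub>R w n \<in> F x"
      unfolding tangent_cone_def by blast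
    have "\<forall>n. \<exists>d. y + h n *\<^sub>R w n = (\<Sum>i\<in>I. d i *\<^sub>R f i x) \<and> (\<forall>i\<in>I. 0 \<le> d i) \<and> sum d I = 1"
      using in_F by (auto simp: F convex_hull_image[OF I])
    then obtain d where d: "\<And>n. y + h n *\<^sub>R w n = (\<Sum>i\<in>I. d n i *\<^sub>R f i x)"
      "\<And>n. \<forall>i\<in>I. 0 \<le> d n i" "\<And>n. sum (d n) I = 1"
      by metis
    have "(\<lambda>n. y + h n *\<^sub>R w n) \<longlonglongrightarrow> y"
      using tendsto_add[OF tendsto_const tendsto_scaleR[OF h(2) w], of y] by simp
    then have dc: "(\<lambda>n. d n i) \<longlonglongrightarrow> c i" if "i \<in> I" for i
      using that d by (intro weights) auto
    have cancel: "h n *\<^sub>R (r *\<^sub>R (z /\<^sub>R h n)) = r *\<^sub>R z" for n r and z :: 'b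
    proof -
      have "h n * (r * inverse (h n)) = r" using h(1)[of n] by (simp add: field_simps)
      then show ?thesis by simp
    qed
    \<comment> \<open>The reverse construction: the weights of \<open>y + h n *\<^sub>R w n\<close>
      are kept while the argument moves from \<open>x\<close> to \<open>x + h n *\<^sub>R u\<close>
      with \<open>u\<close> fixed.\<close>
    define b where "b n = w n + (\<Sum>i\<in>I. d n i *\<^sub>R ((f i (x + h n *\<^sub>R u) - f i x) /\<^sub>R h n))" for n
    have "b \<longlonglongrightarrow> v - (\<Sum>i\<in>I. c i *\<^sub>R f' i u) + (\<Sum>i\<in>I. c i *\<^sub>R f' i u)"
      unfolding b_def by (intro tendsto_add w quot[OF dc h tendsto_const])
    then have "(\<lambda>n. (u, b n)) \<longlonglongrightarrow> (u, v)" by (intro tendsto_Pair) auto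
    moreover have "(x, y) + h n *\<^sub>R (u, b n) \<in> gph F" for n
    proof -
      have "y + h n *\<^sub>R b n = (y + h n *\<^sub>R w n) + (\<Sum>i\<in>I. d n i *\<^sub>R (f i (x + h n *\<^sub>R u) - f i x))"
        by (simp add: b_def scaleR_add_right scaleR_sum_right cancel del: scaleR_scaleR)
      also have "\<dots> = (\<Sum>i\<in>I. d n i *\<^sub>R f i (x + h n *\<^sub>R u))"
        by (simp add: d(1) scaleR_diff_right sum_subtractf)
      finally show ?thesis using d by (auto simp: gph_def F convex_hull_image[OF I])
    qed
    ultimately show "v \<in> graphical_derivative F x y u"
      unfolding graphical_derivative_def tangent_cone_def using h
      by (intro CollectI exI[of _ h] exI[of _ "\<lambda>n. (u, b n)"]) blast
  qed
qed

text \<open>The graph of the derivative is the preimage of \<open>T\<close> under the continuous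
  linear map taking \<open>(u, v)\<close> to \<open>v - A u\<close>, so it inherits closedness and
  the convex cone property.\<close>

lemma set_valued_differentiable_convex_hull:
  fixes f :: "'i \<Rightarrow> 'a::real_normed_vector \<Rightarrow> 'b::euclidean_space"
  assumes I: "finite I" and cont: "\<And>i. i \<in> I \<Longrightarrow> continuous_on UNIV (f i)"
    and ind: "affinely_independent_on I (\<lambda>i. f i x)"
    and D: "\<And>i. i \<in> I \<Longrightarrow> (f i has_derivative f' i) (at x)"
    and F: "F = (\<lambda>x. convex hull ((\<lambda>i. f i x) ` I))" and "y \<in> F x"
  shows "set_valued_differentiable_at F x y"
proof -
  obtain c where c: "\<forall>i\<in>I. 0 \<le> c i" "sum c I = 1" and y: "y = (\<Sum>i\<in>I. c i *\<^sub>R f i x)"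
    using \<open>y \<in> F x\<close> by (auto simp: F convex_hull_image[OF I])
  define A where "A u = (\<Sum>i\<in>I. c i *\<^sub>R f' i u)" for u
  have A: "bounded_linear A"
    unfolding A_def by (intro bounded_linear_sum bounded_linear_const_scaleR has_derivative_bounded_linear[OF D])
  interpret A: bounded_linear A by (rule A)
  define T where "T = tangent_cone (F x) y"
  have gph: "gph (graphical_derivative F x y) = {p. snd p - A (fst p) \<in> T}"
    using graphical_derivative_convex_hull[OF I ind D F c y]
    by (auto simp: gph_def A_def T_def)
  have "convex_cone T"
    unfolding T_def by (rule convex_cone_tangent_cone[OF _ \<open>y \<in> F x\<close>]) (simp add: F)
  then have "convex_cone (gph (graphical_derivative F x y))"
    unfolding gph convex_cone_iff
    by (auto simp: A.add A.scaleR A.zero add_diff_add scaleR_diff_right[symmetric])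
  moreover have "closed (gph (graphical_derivative F x y))"
  proof -
    have "closed ((\<lambda>p. snd p - A (fst p)) -` T)"
      unfolding T_def
      by (intro closed_vimage closed_tangent_cone continuous_intros A.continuous_on)
    then show ?thesis by (simp add: gph vimage_def)
  qed
  ultimately show ?thesis
    using closed_gph_convex_hull[of I f, OF I cont] \<open>y \<in> F x\<close>
    unfolding set_valued_differentiable_at_def convex_process_def F[symmetric]
    by (simp add: gph_def[of F])
qed

theorem proposition4p1:
  fixes N :: nat
    and f :: "nat \<Rightarrow> real ^ 'd \<Rightarrow> real ^ 'l"
    and F :: "real ^ 'd \<Rightarrow> (real ^ 'l) set"
  assumes "N \<ge> 1"
    and "\<And>i. i \<in> {1..N} \<Longrightarrow> \<exists>L. L-lipschitz_on UNIV (f i)"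
    and "\<And>x. affinely_independent_on {1..N} (\<lambda>i. f i x)"
    and "\<And>x. F x = convex hull ((\<lambda>i. f i x) ` {1..N})"
  shows "AE x in lebesgue.
    (\<forall>j\<in>{1..N}. f j differentiable (at x)) \<and>
    (\<forall>y\<in>F x.
      set_valued_differentiable_at F x y \<and>
      (\<forall>c :: nat \<Rightarrow> real.
        (\<forall>j\<in>{1..N}. c j \<in> {0..1}) \<and> (\<Sum>j=1..N. c j) = 1 \<and> y = (\<Sum>j=1..N. c j *\<^sub>R f j x) \<longrightarrow>
        (\<forall>u. graphical_derivative F x y u =
          (\<lambda>v. (\<Sum>j=1..N. c j *\<^sub>R frechet_derivative (f j) (at x) u) + v) ` tangent_cone (F x) y)))"
proof -
  have F: "F = (\<lambda>x. convex hull ((\<lambda>i. f i x) ` {1..N}))" using assms(4) by auto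
  have cont: "continuous_on UNIV (f i)" if "i \<in> {1..N}" for i
    using assms(2)[OF that] lipschitz_on_continuous_on by blast
  \<comment> \<open>The exceptional set is the set where some \<open>f j\<close> is not
    differentiable. It depends neither on \<open>y\<close> nor on the weights, so one null set
    serves for all of them.\<close>
  have "AE x in lborel. f j differentiable (at x)" if "j \<in> {1..N}" for j
    using assms(2)[OF that] Rademacher by blast
  then have "AE x in lborel. \<forall>j\<in>{1..N}. f j differentiable (at x)"
    by (simp add: AE_ball_countable countable_finite del: atLeastAtMost_iff)
  then have "AE x in lebesgue. \<forall>j\<in>{1..N}. f j differentiable (at x)" by (rule AE_completion)
  then show ?thesis
  proof eventually_elim
    case (elim x)
    then have D: "(f j has_derivative frechet_derivative (f j) (at x)) (at x)" if "j \<in> {1..N}" for j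
      using that frechet_derivative_works by blast
    show ?case
    proof (intro conjI ballI allI impI)
      fix y assume "y \<in> F x"
      then show "set_valued_differentiable_at F x y"
        by (intro set_valued_differentiable_convex_hull[where f' = "\<lambda>j. frechet_derivative (f j) (at x)", OF finite_atLeastAtMost _ assms(3) _ F] cont D)
    next
      fix y c u
      assume "(\<forall>j\<in>{1..N}. c j \<in> {0..1}) \<and> (\<Sum>j=1..N. c j) = 1 \<and> y = (\<Sum>j=1..N. c j *\<^sub>R f j x)"
      then have iff: "v \<in> graphical_derivative F x y u \<longleftrightarrow>
          v - (\<Sum>j=1..N. c j *\<^sub>R frechet_derivative (f j) (at x) u) \<in> tangent_cone (F x) y" for v
        by (intro graphical_derivative_convex_hull[OF finite_atLeastAtMost assms(3) _ F] D) auto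
      show "graphical_derivative F x y u =
          (\<lambda>v. (\<Sum>j=1..N. c j *\<^sub>R frechet_derivative (f j) (at x) u) + v) ` tangent_cone (F x) y"
      proof (intro equalityI subsetI)
        fix v assume "v \<in> graphical_derivative F x y u"
        then show "v \<in> (\<lambda>v. (\<Sum>j=1..N. c j *\<^sub>R frechet_derivative (f j) (at x) u) + v) ` tangent_cone (F x) y"
          unfolding iff by (rule image_eqI[rotated]) simp
      qed (auto simp: iff)
    qed (use elim in blast)
  qed
qed

end
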